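(* Let $\rho\in(1,2]$, $\mu,\lambda>0$ and $T>0$. Let $\{\alpha_k\}_{k\ge1}$ be i.i.d. random variables with the Gamma distribution $\Gamma(\mu,\lambda)$ on $(\bar\Omega,\bar{\mathcal F},\bar{\mathbb P})$, and let $W$ be a standard Brownian motion on $(\Omega,\mathcal F,\mathbb P)$. Let $Y_n(t)=\int_0^t \frac1n\sum_{k=1}^n s_{\alpha_k}(t-\tau)\,dW(\tau)$ and $Y(t)=\int_0^t G_\rho^\mu\left(-\frac{(t-\tau)^\rho}{\lambda}\right)dW(\tau)$, regarded as processes with continuous paths on $[0,T]$. Then, for $\bar{\mathbb P}$-a.e. realization of $(\alpha_k)_{k\ge1}$, the sequence $Y_n$ converges $\mathbb P$-weakly to $Y$ in $C([0,T])$ as $n\to\infty$, i.e. the laws under $\mathbb P$ of $Y_n$ on $C([0,T])$ (with the uniform topology) converge weakly to the law under $\mathbb P$ of $Y$.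
   Context: The space $(\bar\Omega,\bar{\mathcal F},\bar{\mathbb P})$ carrying the $\alpha_k$ is different from the space $(\Omega,\mathcal F,\mathbb P)$ carrying $W$, and the $\alpha_k$ are independent of $W$; the stochastic integrals are Wiener integrals under $\mathbb P$ with the realization of $(\alpha_k)$ fixed. The distribution $\Gamma(\mu,\lambda)$ has density $f(x)=\frac{1}{\Gamma(\mu)}\lambda e^{-\lambda x}(\lambda x)^{\mu-1}$ for $x>0$. With $g_\rho(t)=t^{\rho-1}/\Gamma(\rho)$, for $\alpha\ge0$ the scalar resolvent $s_\alpha:[0,\infty)\to\mathbb R$ is the solution of $s_\alpha(t)+\alpha\int_0^t g_\rho(t-\tau)s_\alpha(\tau)\,d\tau=1$, $t\ge0$; equivalently $s_\alpha(t)=E_\rho(-\alpha t^\rho)$ with $E_\rho(z)=\sum_{k\ge0}\frac{z^k}{\Gamma(\rho k+1)}$ the Mittag-Leffler function. $G_\rho^\mu(z)=\sum_{k=0}^\infty\frac{(\mu)_k}{\Gamma(k\rho+1)}z^k$, where $(\mu)_k=\Gamma(\mu+k)/\Gamma(\mu)$. *)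

theory Defs
  imports "HOL-Probability.Probability"
begin

definition gamma_density :: "real \<Rightarrow> real \<Rightarrow> real \<Rightarrow> real" where
  "gamma_density \<mu> l x =
     (if x > 0 then 1 / Gamma \<mu> * l * exp (- l * x) * (l * x) powr (\<mu> - 1) else 0)"

definition frac_kernel :: "real \<Rightarrow> real \<Rightarrow> real" where
  "frac_kernel \<rho> t = t powr (\<rho> - 1) / Gamma \<rho>"

text \<open>The Volterra equation determines a continuous solution on \<open>[0,\<infinity>)\<close> uniquely;
  values at negative arguments are unconstrained.\<close>

definition scalar_resolvent :: "real \<Rightarrow> real \<Rightarrow> (real \<Rightarrow> real) \<Rightarrow> bool" where
  "scalar_resolvent \<rho> a s \<longleftrightarrow>
     continuous_on {0..} s \<and>
     (\<forall>t\<ge>0. s t + a * (LBINT \<tau>:{0..t}. frac_kernel \<rho> (t - \<tau>) * s \<tau>) = 1)"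

definition G_fun :: "real \<Rightarrow> real \<Rightarrow> real \<Rightarrow> real" where
  "G_fun \<rho> \<mu> z = (\<Sum>k. pochhammer \<mu> k / Gamma (real k * \<rho> + 1) * z ^ k)"

text \<open>Processes are indexed by real time; only times \<open>t \<ge> 0\<close> are relevant.\<close>

definition brownian_motion :: "'a measure \<Rightarrow> (real \<Rightarrow> 'a \<Rightarrow> real) \<Rightarrow> bool" where
  "brownian_motion M W \<longleftrightarrow>
     prob_space M \<and>
     (\<forall>t\<ge>0. W t \<in> borel_measurable M) \<and>
     (AE \<omega> in M. W 0 \<omega> = 0) \<and>
     (\<forall>(p :: nat \<Rightarrow> real) n. 0 \<le> p 0 \<longrightarrow> mono p \<longrightarrow>
        prob_space.indep_vars M (\<lambda>_. borel) (\<lambda>i \<omega>. W (p (Suc i)) \<omega> - W (p i) \<omega>) {..<n}) \<and>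
     (\<forall>u t. 0 \<le> u \<longrightarrow> u < t \<longrightarrow>
        distributed M lborel (\<lambda>\<omega>. W t \<omega> - W u \<omega>) (\<lambda>x. ennreal (normal_density 0 (sqrt (t - u)) x))) \<and>
     (AE \<omega> in M. continuous_on {0..} (\<lambda>t. W t \<omega>))"

text \<open>Step functions with breakpoints \<open>p 0 \<le> \<dots> \<le> p m\<close> and values \<open>c 0, \<dots>, c (m - 1)\<close>,
  and their integrals with respect to \<open>W\<close>.\<close>

definition step_fun :: "(nat \<Rightarrow> real) \<Rightarrow> (nat \<Rightarrow> real) \<Rightarrow> nat \<Rightarrow> real \<Rightarrow> real" where
  "step_fun p c m \<tau> = (\<Sum>i<m. c i * indicator {p i<..p (Suc i)} \<tau>)"

definition step_integral ::
  "(real \<Rightarrow> 'a \<Rightarrow> real) \<Rightarrow> (nat \<Rightarrow> real) \<Rightarrow> (nat \<Rightarrow> real) \<Rightarrow> nat \<Rightarrow> 'a \<Rightarrow> real" where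
  "step_integral W p c m \<omega> = (\<Sum>i<m. c i * (W (p (Suc i)) \<omega> - W (p i) \<omega>))"

text \<open>The Wiener integral of a deterministic \<open>f \<in> L\<^sup>2(0,t)\<close> is the \<open>L\<^sup>2\<close>-limit of the integrals of
  step functions converging to \<open>f\<close> in \<open>L\<^sup>2(0,t)\<close>.  By the Ito isometry it is determined almost
  surely, so it is rendered as a relation: \<open>I\<close> is a version of \<open>\<integral>\<^sub>0\<^sup>t f dW\<close>.\<close>

definition has_wiener_integral ::
  "'a measure \<Rightarrow> (real \<Rightarrow> 'a \<Rightarrow> real) \<Rightarrow> real \<Rightarrow> (real \<Rightarrow> real) \<Rightarrow> ('a \<Rightarrow> real) \<Rightarrow> bool" where
  "has_wiener_integral M W t f I \<longleftrightarrow>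
     set_borel_measurable lborel {0..t} f \<and>
     set_integrable lborel {0..t} (\<lambda>\<tau>. (f \<tau>)\<^sup>2) \<and>
     I \<in> borel_measurable M \<and>
     (\<exists>p c m.
        (\<forall>j. mono (p j) \<and> range (p j) \<subseteq> {0..t}) \<and>
        (\<lambda>j :: nat. \<integral>\<^sup>+\<tau>\<in>{0..t}. ennreal ((f \<tau> - step_fun (p j) (c j) (m j) \<tau>)\<^sup>2) \<partial>lborel)
          \<longlonglongrightarrow> 0 \<and>
        (\<lambda>j :: nat. \<integral>\<^sup>+\<omega>. ennreal ((I \<omega> - step_integral W (p j) (c j) (m j) \<omega>)\<^sup>2) \<partial>M)
          \<longlonglongrightarrow> 0)"

text \<open>\<open>Y\<close> is a version with continuous paths on \<open>[0,T]\<close> of the process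
  \<open>t \<mapsto> \<integral>\<^sub>0\<^sup>t k(t - \<tau>) dW(\<tau>)\<close>.\<close>

definition continuous_wiener_convolution ::
  "'a measure \<Rightarrow> (real \<Rightarrow> 'a \<Rightarrow> real) \<Rightarrow> real \<Rightarrow> (real \<Rightarrow> real) \<Rightarrow> (real \<Rightarrow> 'a \<Rightarrow> real) \<Rightarrow> bool" where
  "continuous_wiener_convolution M W T k Y \<longleftrightarrow>
     (\<forall>t\<in>{0..T}. has_wiener_integral M W t (\<lambda>\<tau>. k (t - \<tau>)) (Y t)) \<and>
     (\<forall>\<omega>\<in>space M. continuous_on {0..T} (\<lambda>t. Y t \<omega>))"

text \<open>\<open>C([0,T])\<close> with the supremum metric; its elements are extensional on \<open>[0,T]\<close>.\<close>

definition path_space :: "real \<Rightarrow> (real \<Rightarrow> real) topology" where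
  "path_space T = mtopology_of (cfunspace (top_of_set {0..T}) euclidean_metric)"

definition borel_of_topology :: "'b topology \<Rightarrow> 'b measure" where
  "borel_of_topology X = sigma (topspace X) {U. openin X U}"

definition path_law :: "'a measure \<Rightarrow> real \<Rightarrow> (real \<Rightarrow> 'a \<Rightarrow> real) \<Rightarrow> (real \<Rightarrow> real) measure" where
  "path_law M T Y =
     distr M (borel_of_topology (path_space T)) (\<lambda>\<omega>. restrict (\<lambda>t. Y t \<omega>) {0..T})"

text \<open>Weak convergence of Borel probability measures on \<open>X\<close>.  Being a Borel probability measure is
  part of the assertion: \<^const>\<open>distr\<close> along a non-measurable map is not a probability measure,
  so a statement about \<^const>\<open>path_law\<close> cannot hold merely for lack of measurability.\<close>

definition borel_prob_on :: "'b topology \<Rightarrow> 'b measure \<Rightarrow> bool" where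
  "borel_prob_on X P \<longleftrightarrow>
     prob_space P \<and> space P = topspace X \<and> sets P = sets (borel_of_topology X)"

definition weakly_converges ::
  "'b topology \<Rightarrow> (nat \<Rightarrow> 'b measure) \<Rightarrow> 'b measure \<Rightarrow> bool" where
  "weakly_converges X P Q \<longleftrightarrow>
     (\<forall>n. borel_prob_on X (P n)) \<and> borel_prob_on X Q \<and>
     (\<forall>F. continuous_map X euclideanreal F \<longrightarrow> bounded (F ` topspace X) \<longrightarrow>
        (\<lambda>n. \<integral>x. F x \<partial>P n) \<longlonglongrightarrow> (\<integral>x. F x \<partial>Q))"

end

theory Submission
  imports Defs "HOL-Library.Discrete_Functions"
begin

text \<open>All processes are driven by the same \<open>W\<close>, so the convergence is in fact almost surely uniform
  under \<open>M\<close>. Let \<open>h = k\<^sub>n - k\<close> be the difference of the two kernels. It vanishes at \<open>0\<close>,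
  and summation by parts in Riemann sums bounds \<open>\<bar>Y\<^sub>n t - Y t\<bar>\<close> by twice the variation of \<open>h\<close> on
  \<open>[0,T]\<close> times the supremum of \<open>\<bar>W\<bar>\<close>. Both kernels are power series in \<open>u powr \<rho>\<close>: the
  coefficients of \<open>k\<^sub>n\<close> contain the empirical moments of the sample, those of \<open>k\<close> the moments of
  the Gamma distribution. The variation of \<open>h\<close> is therefore at most the weighted \<open>\<ell>\<^sup>1\<close> distance
  of the moment sequences, which tends to \<open>0\<close> by the strong law of large numbers for each moment
  and for one exponential moment; the latter controls the tails because \<open>\<rho> > 1\<close> makes
  \<open>Gamma (\<rho> * j + 1)\<close> grow faster than \<open>fact j\<close> times any geometric sequence.\<close>

subsection \<open>The Ito isometry and a pathwise bound for Wiener integrals\<close>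

text \<open>The obstacle is that \<open>has_wiener_integral\<close> only asserts that some
  approximating step functions exist, so it gives no hold on single paths. The isometry transfers
  any L^2 approximation of the kernel difference to the integrals, and Riemann sums with (k+1)^2
  cells converge fast enough in L^2 to converge almost surely; only then does a pathwise bound pass
  to the limit. That bound holds off a null set depending on n and t, hence the passage through
  rational times and continuity of the paths. The variation of a power series in an increasing
  variable is controlled by the series with absolute coefficients, so only coefficients have to be
  compared. The law of large numbers is applied to nonnegative functions of the samples with finite
  second moment, which permits a proof by variances along the squares; the second moment of exp (e
  x) is finite because 2 e < l. Finally, that the path laws are Borel probability measures is proved
  through separability of C([0,T]).\<close>

lemma summable_inverse_Suc_square: "summable (\<lambda>n. inverse (real (Suc n) ^ 2))"
  using inverse_power_summable[of 2, where 'a = real] summable_Suc_iff[of "\<lambda>n. inverse (real n ^ 2)"]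
  by simp

text \<open>By Tonelli the sum of the squares has finite integral, so it is almost surely finite and
  its terms tend to 0. Serves both the Riemann sums and the law of large numbers, each time with a
  bound of order 1/(k+1)^2.\<close>

lemma AE_tendsto_zero_if_summable_L2:
  fixes X :: "nat \<Rightarrow> 'a \<Rightarrow> real"
  assumes [measurable]: "\<And>k. X k \<in> borel_measurable M"
    and le: "\<And>k. (\<integral>\<^sup>+\<omega>. ennreal ((X k \<omega>)\<^sup>2) \<partial>M) \<le> ennreal (a k)"
    and a: "\<And>k. 0 \<le> a k" "summable a"
  shows "AE \<omega> in M. (\<lambda>k. X k \<omega>) \<longlonglongrightarrow> 0"
proof -
  have "(\<integral>\<^sup>+\<omega>. (\<Sum>k. ennreal ((X k \<omega>)\<^sup>2)) \<partial>M) = (\<Sum>k. \<integral>\<^sup>+\<omega>. ennreal ((X k \<omega>)\<^sup>2) \<partial>M)"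
    by (rule nn_integral_suminf) measurable
  also have "\<dots> \<le> (\<Sum>k. ennreal (a k))"
    by (intro suminf_le le) auto
  also have "\<dots> = ennreal (\<Sum>k. a k)"
    using a by (intro suminf_ennreal2) auto
  finally have "(\<integral>\<^sup>+\<omega>. (\<Sum>k. ennreal ((X k \<omega>)\<^sup>2)) \<partial>M) \<noteq> \<infinity>"
    by (auto simp: top_unique)
  then have "AE \<omega> in M. (\<Sum>k. ennreal ((X k \<omega>)\<^sup>2)) \<noteq> \<infinity>"
    by (intro nn_integral_PInf_AE) measurable
  then show ?thesis
  proof eventually_elim
    case (elim \<omega>)
    have "summable (\<lambda>k. (X k \<omega>)\<^sup>2)"
      using elim by (intro summable_suminf_not_top) auto
    then have "(\<lambda>k. (X k \<omega>)\<^sup>2) \<longlonglongrightarrow> 0"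
      by (rule summable_LIMSEQ_zero)
    then have "(\<lambda>k. sqrt ((X k \<omega>)\<^sup>2)) \<longlonglongrightarrow> sqrt 0"
      by (intro tendsto_real_sqrt)
    then show ?case by (simp add: tendsto_rabs_zero_iff)
  qed
qed

lemma brownian_increment_second_moment:
  assumes "brownian_motion M W" "0 \<le> u" "u \<le> t"
  shows "integrable M (\<lambda>\<omega>. (W t \<omega> - W u \<omega>)\<^sup>2)"
    and "(\<integral>\<omega>. (W t \<omega> - W u \<omega>)\<^sup>2 \<partial>M) = t - u"
proof -
  have "integrable M (\<lambda>\<omega>. (W t \<omega> - W u \<omega>)\<^sup>2) \<and> (\<integral>\<omega>. (W t \<omega> - W u \<omega>)\<^sup>2 \<partial>M) = t - u"
  \<comment> \<open>The density assumption covers \<open>u < t\<close> only; for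
    \<open>u = t\<close> both sides vanish.\<close>
  proof (cases "u = t")
    case False
    then have ut: "u < t" using assms by simp
    then have D: "distributed M lborel (\<lambda>\<omega>. W t \<omega> - W u \<omega>)
        (\<lambda>x. ennreal (normal_density 0 (sqrt (t - u)) x))"
      using assms unfolding brownian_motion_def by blast
    have "integrable lborel (\<lambda>x. normal_density 0 (sqrt (t - u)) x * x\<^sup>2)"
      using integrable_normal_moment[of "sqrt (t - u)" 0 2] ut by simp
    moreover have "(\<integral>x. normal_density 0 (sqrt (t - u)) x * x\<^sup>2 \<partial>lborel) = t - u"
      using integral_normal_moment_even[of "sqrt (t - u)" 0 1] ut by (simp add: fact_numeral)
    ultimately show ?thesis
      using distributed_integrable[OF D, of "\<lambda>x. x\<^sup>2"] distributed_integral[OF D, of "\<lambda>x. x\<^sup>2"]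
      by simp
  qed simp
  then show "integrable M (\<lambda>\<omega>. (W t \<omega> - W u \<omega>)\<^sup>2)"
    and "(\<integral>\<omega>. (W t \<omega> - W u \<omega>)\<^sup>2 \<partial>M) = t - u" by auto
qed

lemma brownian_second_moment:
  assumes "brownian_motion M W" "0 \<le> t"
  shows "integrable M (\<lambda>\<omega>. (W t \<omega>)\<^sup>2)" and "(\<integral>\<omega>. (W t \<omega>)\<^sup>2 \<partial>M) = t"
proof -
  have [measurable]: "W t \<in> borel_measurable M" "W 0 \<in> borel_measurable M"
    and "AE \<omega> in M. W 0 \<omega> = 0"
    using assms unfolding brownian_motion_def by auto
  then have ae: "AE \<omega> in M. (W t \<omega>)\<^sup>2 = (W t \<omega> - W 0 \<omega>)\<^sup>2"
    by (auto elim: eventually_mono)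
  show "integrable M (\<lambda>\<omega>. (W t \<omega>)\<^sup>2)"
    by (subst integrable_cong_AE[OF _ _ ae])
       (use brownian_increment_second_moment[OF assms(1), of 0 t] assms in auto)
  show "(\<integral>\<omega>. (W t \<omega>)\<^sup>2 \<partial>M) = t"
    by (subst integral_cong_AE[OF _ _ ae])
       (use brownian_increment_second_moment[OF assms(1), of 0 t] assms in auto)
qed

lemma brownian_covariance:
  assumes "brownian_motion M W" "0 \<le> u" "0 \<le> t"
  shows "integrable M (\<lambda>\<omega>. W u \<omega> * W t \<omega>)" and "(\<integral>\<omega>. W u \<omega> * W t \<omega> \<partial>M) = min u t"
proof -
  \<comment> \<open>polarization\<close>
  have eq: "(\<lambda>\<omega>. W u \<omega> * W t \<omega>) =
      (\<lambda>\<omega>. ((W u \<omega>)\<^sup>2 + (W t \<omega>)\<^sup>2 - (W (max u t) \<omega> - W (min u t) \<omega>)\<^sup>2) / 2)"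
    by (auto simp: fun_eq_iff max_def min_def power2_eq_square algebra_simps)
  note I = brownian_second_moment[OF assms(1,2)] brownian_second_moment[OF assms(1,3)]
    brownian_increment_second_moment[OF assms(1), of "min u t" "max u t"]
  show "integrable M (\<lambda>\<omega>. W u \<omega> * W t \<omega>)"
    unfolding eq using I assms by auto
  show "(\<integral>\<omega>. W u \<omega> * W t \<omega> \<partial>M) = min u t"
    unfolding eq using I assms by (auto simp: min_def max_def)
qed

text \<open>Bilinear expansion leaves four minima whose alternating sum is the length of the overlap
  of the two intervals, that is, the L^2 inner product of their indicators.\<close>

lemma brownian_increment_covariance:
  assumes W: "brownian_motion M W" and "0 \<le> a" "a \<le> b" "0 \<le> c" "c \<le> d"
  shows "integrable M (\<lambda>\<omega>. (W b \<omega> - W a \<omega>) * (W d \<omega> - W c \<omega>))"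
    and "(\<integral>\<omega>. (W b \<omega> - W a \<omega>) * (W d \<omega> - W c \<omega>) \<partial>M)
       = (\<integral>\<tau>. indicator {a<..b} \<tau> * indicator {c<..d} \<tau> \<partial>lborel)"
    and "integrable lborel (\<lambda>\<tau>. indicator {a<..b} \<tau> * indicator {c<..d} \<tau> :: real)"
proof -
  have eq: "(\<lambda>\<omega>. (W b \<omega> - W a \<omega>) * (W d \<omega> - W c \<omega>)) =
      (\<lambda>\<omega>. W b \<omega> * W d \<omega> - W b \<omega> * W c \<omega> - W a \<omega> * W d \<omega> + W a \<omega> * W c \<omega>)"
    by (simp add: fun_eq_iff algebra_simps)
  have nn: "0 \<le> b" "0 \<le> d" using assms by auto
  note I = brownian_covariance[OF W \<open>0 \<le> b\<close> \<open>0 \<le> d\<close>] brownian_covariance[OF W \<open>0 \<le> b\<close> \<open>0 \<le> c\<close>]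
    brownian_covariance[OF W \<open>0 \<le> a\<close> \<open>0 \<le> d\<close>] brownian_covariance[OF W \<open>0 \<le> a\<close> \<open>0 \<le> c\<close>]
  show "integrable M (\<lambda>\<omega>. (W b \<omega> - W a \<omega>) * (W d \<omega> - W c \<omega>))"
    unfolding eq using I by auto
  have ind: "(\<lambda>\<tau>. indicator {a<..b} \<tau> * indicator {c<..d} \<tau> :: real)
      = indicator {max a c<..min b d}"
    by (auto simp: fun_eq_iff indicator_def)
  have fin: "emeasure lborel {max a c<..min b d} < \<infinity>"
    by (cases "max a c \<le> min b d") auto
  show "integrable lborel (\<lambda>\<tau>. indicator {a<..b} \<tau> * indicator {c<..d} \<tau> :: real)"
    unfolding ind using fin by (intro integrable_real_indicator) auto
  have "(\<integral>\<omega>. (W b \<omega> - W a \<omega>) * (W d \<omega> - W c \<omega>) \<partial>M)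
      = min b d - min b c - min a d + min a c"
    unfolding eq using I by simp
  also have "\<dots> = measure lborel {max a c<..min b d}"
  proof (cases "max a c \<le> min b d")
    case True
    then show ?thesis using assms by (auto simp: min_def max_def split: if_splits)
  next
    case False
    then have "{max a c<..min b d} = {}" by auto
    then show ?thesis using False assms by (auto simp: min_def max_def)
  qed
  finally show "(\<integral>\<omega>. (W b \<omega> - W a \<omega>) * (W d \<omega> - W c \<omega>) \<partial>M)
       = (\<integral>\<tau>. indicator {a<..b} \<tau> * indicator {c<..d} \<tau> \<partial>lborel)"
    unfolding ind by simp
qed

text \<open>The intervals may overlap and come in any order. Hence a combination of step integrals
  over different partitions is covered directly, without a common refinement.\<close>

lemma wiener_isometry:
  fixes c a b :: "'i \<Rightarrow> real"
  assumes W: "brownian_motion M W" and "finite A"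
    and ab: "\<And>i. i \<in> A \<Longrightarrow> 0 \<le> a i \<and> a i \<le> b i"
  shows "(\<integral>\<^sup>+\<omega>. ennreal ((\<Sum>i\<in>A. c i * (W (b i) \<omega> - W (a i) \<omega>))\<^sup>2) \<partial>M)
       = (\<integral>\<^sup>+\<tau>. ennreal ((\<Sum>i\<in>A. c i * indicator {a i<..b i} \<tau>)\<^sup>2) \<partial>lborel)"
proof -
  have sq1: "(\<Sum>i\<in>A. c i * (W (b i) \<omega> - W (a i) \<omega>))\<^sup>2 =
      (\<Sum>i\<in>A. \<Sum>j\<in>A. (c i * c j) * ((W (b i) \<omega> - W (a i) \<omega>) * (W (b j) \<omega> - W (a j) \<omega>)))" for \<omega>
    by (simp add: power2_eq_square sum_product mult_ac)
  have sq2: "(\<Sum>i\<in>A. c i * indicator {a i<..b i} \<tau>)\<^sup>2 =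
      (\<Sum>i\<in>A. \<Sum>j\<in>A. (c i * c j) * (indicator {a i<..b i} \<tau> * indicator {a j<..b j} \<tau>))" for \<tau>
    by (simp add: power2_eq_square sum_product mult_ac)
  note C = brownian_increment_covariance[OF W]
  have int1: "integrable M (\<lambda>\<omega>. (\<Sum>i\<in>A. c i * (W (b i) \<omega> - W (a i) \<omega>))\<^sup>2)"
    unfolding sq1 using ab
    by (auto intro!: Bochner_Integration.integrable_sum integrable_mult_right C(1)
        simp del: integrable_mult_right_iff)
  have int2: "integrable lborel (\<lambda>\<tau>. (\<Sum>i\<in>A. c i * indicator {a i<..b i} \<tau>)\<^sup>2)"
    unfolding sq2 using ab
    by (auto intro!: Bochner_Integration.integrable_sum integrable_mult_right C(3)
        simp del: integrable_mult_right_iff)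
  have "(\<integral>\<^sup>+\<omega>. ennreal ((\<Sum>i\<in>A. c i * (W (b i) \<omega> - W (a i) \<omega>))\<^sup>2) \<partial>M)
      = ennreal (\<integral>\<omega>. (\<Sum>i\<in>A. c i * (W (b i) \<omega> - W (a i) \<omega>))\<^sup>2 \<partial>M)"
    by (rule nn_integral_eq_integral[OF int1]) simp
  also have "(\<integral>\<omega>. (\<Sum>i\<in>A. c i * (W (b i) \<omega> - W (a i) \<omega>))\<^sup>2 \<partial>M)
      = (\<Sum>i\<in>A. \<Sum>j\<in>A. c i * c j *
          (\<integral>\<omega>. (W (b i) \<omega> - W (a i) \<omega>) * (W (b j) \<omega> - W (a j) \<omega>) \<partial>M))"
    unfolding sq1 using ab
    by (simp add: Bochner_Integration.integral_sum C)
  also have "\<dots> = (\<Sum>i\<in>A. \<Sum>j\<in>A. c i * c j *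
          (\<integral>\<tau>. indicator {a i<..b i} \<tau> * indicator {a j<..b j} \<tau> \<partial>lborel))"
    using ab by (intro sum.cong refl) (simp add: C)
  also have "\<dots> = (\<integral>\<tau>. (\<Sum>i\<in>A. c i * indicator {a i<..b i} \<tau>)\<^sup>2 \<partial>lborel)"
    unfolding sq2 using ab
    by (subst Bochner_Integration.integral_sum
      | auto intro!: sum.cong Bochner_Integration.integrable_sum integrable_mult_right C(3) simp del: integrable_mult_right_iff)+
  also have "ennreal \<dots> = (\<integral>\<^sup>+\<tau>. ennreal ((\<Sum>i\<in>A. c i * indicator {a i<..b i} \<tau>)\<^sup>2) \<partial>lborel)"
    by (rule nn_integral_eq_integral[OF int2, symmetric]) simp
  finally show ?thesis .
qed

section \<open>Step functions on partitions: L^2 and pathwise estimates\<close>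

lemma step_fun_eq:
  assumes "mono p" "i < m" "\<tau> \<in> {p i<..p (Suc i)}"
  shows "step_fun p c m \<tau> = c i"
proof -
  have "c j * indicator {p j<..p (Suc j)} \<tau> = (if j = i then c j else 0)" for j
  proof (cases j i rule: linorder_cases)
    case less
    then have "p (Suc j) \<le> p i" using assms(1) by (simp add: mono_def)
    then show ?thesis using assms(3) less by (auto simp: indicator_def)
  next
    case greater
    then have "p (Suc i) \<le> p j" using assms(1) by (simp add: mono_def)
    then show ?thesis using assms(3) greater by (auto simp: indicator_def)
  qed (use assms in auto)
  then show ?thesis unfolding step_fun_def using assms(2) by simp
qed

lemma in_partition_cell:
  fixes p :: "nat \<Rightarrow> real"
  assumes "p 0 < \<tau>" "\<tau> \<le> p m"
  shows "\<exists>i<m. \<tau> \<in> {p i<..p (Suc i)}"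
  using assms(2)
proof (induction m)
  case 0
  then show ?case using assms(1) by simp
next
  case (Suc m)
  then show ?case by (cases "\<tau> \<le> p m") (auto simp: less_Suc_eq)
qed

lemma step_fun_measurable[measurable]: "step_fun p c m \<in> borel_measurable borel"
  unfolding step_fun_def[abs_def] by measurable

lemma step_fun_outside:
  assumes "\<And>i. i \<le> m \<Longrightarrow> p i \<in> {0..t}" "\<tau> \<notin> {0..t}"
  shows "step_fun p c m \<tau> = 0"
proof -
  have "\<tau> \<notin> {p i<..p (Suc i)}" if "i < m" for i
    using assms(1)[of i] assms(1)[of "Suc i"] assms(2) that by auto
  then show ?thesis by (simp add: step_fun_def)
qed

lemma sum_by_parts:
  fixes h w :: "nat \<Rightarrow> real"
  shows "(\<Sum>i<m. h i * (w (Suc i) - w i))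
       = h m * w m - h 0 * w 0 - (\<Sum>i<m. w (Suc i) * (h (Suc i) - h i))"
  by (induction m) (simp_all add: algebra_simps)

lemma square_sum3_le:
  fixes x y z :: real
  shows "(x + y + z)\<^sup>2 \<le> 3 * x\<^sup>2 + 3 * y\<^sup>2 + 3 * z\<^sup>2"
  using zero_le_power2[of "x - y"] zero_le_power2[of "y - z"] zero_le_power2[of "x - z"]
  by (simp add: power2_eq_square algebra_simps)

lemma nn_integral_square_sum3_le:
  fixes x y z :: "'a \<Rightarrow> real"
  assumes [measurable]: "x \<in> borel_measurable M" "y \<in> borel_measurable M" "z \<in> borel_measurable M"
  shows "(\<integral>\<^sup>+\<omega>. ennreal ((x \<omega> + y \<omega> + z \<omega>)\<^sup>2) \<partial>M)
    \<le> 3 * (\<integral>\<^sup>+\<omega>. ennreal ((x \<omega>)\<^sup>2) \<partial>M) + 3 * (\<integral>\<^sup>+\<omega>. ennreal ((y \<omega>)\<^sup>2) \<partial>M)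
      + 3 * (\<integral>\<^sup>+\<omega>. ennreal ((z \<omega>)\<^sup>2) \<partial>M)"
proof -
  have "(\<integral>\<^sup>+\<omega>. ennreal ((x \<omega> + y \<omega> + z \<omega>)\<^sup>2) \<partial>M)
    \<le> (\<integral>\<^sup>+\<omega>. 3 * ennreal ((x \<omega>)\<^sup>2) + 3 * ennreal ((y \<omega>)\<^sup>2) + 3 * ennreal ((z \<omega>)\<^sup>2) \<partial>M)"
  proof (rule nn_integral_mono)
    fix \<omega>
    have "ennreal ((x \<omega> + y \<omega> + z \<omega>)\<^sup>2)
        \<le> ennreal (3 * (x \<omega>)\<^sup>2 + 3 * (y \<omega>)\<^sup>2 + 3 * (z \<omega>)\<^sup>2)"
      by (intro ennreal_leI square_sum3_le)
    also have "\<dots> = 3 * ennreal ((x \<omega>)\<^sup>2) + 3 * ennreal ((y \<omega>)\<^sup>2) + 3 * ennreal ((z \<omega>)\<^sup>2)"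
      by (simp add: ennreal_plus ennreal_mult')
    finally show "ennreal ((x \<omega> + y \<omega> + z \<omega>)\<^sup>2) \<le> \<dots>" .
  qed
  also have "\<dots> = 3 * (\<integral>\<^sup>+\<omega>. ennreal ((x \<omega>)\<^sup>2) \<partial>M) + 3 * (\<integral>\<^sup>+\<omega>. ennreal ((y \<omega>)\<^sup>2) \<partial>M)
      + 3 * (\<integral>\<^sup>+\<omega>. ennreal ((z \<omega>)\<^sup>2) \<partial>M)"
    by (simp add: nn_integral_add nn_integral_cmult)
  finally show ?thesis .
qed

text \<open>\<open>H\<close> is a decreasing majorant of the oscillation of \<open>h\<close>; it
  decreases because the kernels are read backwards in time. On each cell the squared error is at
  most \<open>V\<close> times the drop of \<open>H\<close> there; the drops telescope and the mesh
  \<open>t / m\<close> supplies the factor 1/m.\<close>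

lemma uniform_step_approximation:
  fixes h H :: "real \<Rightarrow> real"
  assumes "0 \<le> t" "0 < m"
    and H: "\<And>u v. 0 \<le> u \<Longrightarrow> u \<le> v \<Longrightarrow> v \<le> t \<Longrightarrow> \<bar>h u - h v\<bar> \<le> H u - H v"
    and V: "H 0 - H t \<le> V"
  defines "p \<equiv> \<lambda>i. t * real i / real m"
  shows "(\<integral>\<^sup>+\<tau>\<in>{0..t}. ennreal ((h \<tau> - step_fun p (\<lambda>i. h (p i)) m \<tau>)\<^sup>2) \<partial>lborel)
      \<le> ennreal (t * V\<^sup>2 / real m)"
proof -
  have p0: "p 0 = 0" and pm: "p m = t" using assms by (auto simp: p_def)
  have pmono: "mono p" unfolding p_def
    by (intro monoI divide_right_mono mult_left_mono) (use assms in auto)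
  have pnn: "0 \<le> p i" for i using assms by (simp add: p_def)
  have pstep: "p (Suc i) - p i = t / real m" for i
    by (simp add: p_def diff_divide_distrib[symmetric] algebra_simps)
  have pS: "p i \<le> p (Suc i)" for i using pmono by (simp add: mono_def)
  have ple: "p i \<le> t" if "i \<le> m" for i using pmono that pm by (auto simp: mono_def)
  have osc: "0 \<le> H (p i) - H (p (Suc i))" if "i < m" for i
    using H[OF pnn[of i] pS ple[of "Suc i"]] that by simp
  have tele: "(\<Sum>i<m. H (p i) - H (p (Suc i))) = H 0 - H t"
    using sum_lessThan_telescope'[of "\<lambda>i. H (p i)" m] p0 pm by simp
  have V0: "0 \<le> V" using tele V osc sum_nonneg[of "{..<m}" "\<lambda>i. H (p i) - H (p (Suc i))"] by simp
  have "(\<integral>\<^sup>+\<tau>\<in>{0..t}. ennreal ((h \<tau> - step_fun p (\<lambda>i. h (p i)) m \<tau>)\<^sup>2) \<partial>lborel)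
      \<le> (\<integral>\<^sup>+\<tau>. (\<Sum>i<m. ennreal (V * (H (p i) - H (p (Suc i)))) * indicator {p i<..p (Suc i)} \<tau>) \<partial>lborel)"
  proof (rule nn_integral_mono_AE)
    \<comment> \<open>The cells are open on the left, so 0 belongs to none of them.\<close>
    have "AE \<tau> in lborel. \<tau> \<noteq> (0::real)" by (rule AE_lborel_singleton)
    then show "AE \<tau> in lborel. ennreal ((h \<tau> - step_fun p (\<lambda>i. h (p i)) m \<tau>)\<^sup>2) * indicator {0..t} \<tau>
      \<le> (\<Sum>i<m. ennreal (V * (H (p i) - H (p (Suc i)))) * indicator {p i<..p (Suc i)} \<tau>)"
    proof eventually_elim
      case (elim \<tau>)
      show ?case
      proof (cases "\<tau> \<in> {0..t}")
        case True
        then obtain i where i: "i < m" "\<tau> \<in> {p i<..p (Suc i)}"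
          using in_partition_cell[of p \<tau> m] elim p0 pm by auto
        have d: "\<bar>h \<tau> - h (p i)\<bar> \<le> H (p i) - H \<tau>" "0 \<le> H \<tau> - H (p (Suc i))"
            "0 \<le> H 0 - H (p i)" "0 \<le> H (p (Suc i)) - H t"
          using H[of "p i" \<tau>] H[of \<tau> "p (Suc i)"] H[of 0 "p i"] H[of "p (Suc i)" t]
            i True pnn ple[of "Suc i"] ple[of i] by (auto simp: abs_minus_commute)
        have "(h \<tau> - step_fun p (\<lambda>i. h (p i)) m \<tau>)\<^sup>2 = \<bar>h \<tau> - h (p i)\<bar> * \<bar>h \<tau> - h (p i)\<bar>"
          using step_fun_eq[OF pmono i] by (simp add: power2_eq_square)
        \<comment> \<open>One factor is bounded by the total drop, the other by the drop over the
          cell, which keeps the sum over the cells telescoping.\<close>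
        also have "\<dots> \<le> V * (H (p i) - H (p (Suc i)))"
          by (rule mult_mono) (use d V V0 in auto)
        finally have "ennreal ((h \<tau> - step_fun p (\<lambda>i. h (p i)) m \<tau>)\<^sup>2) * indicator {0..t} \<tau>
            \<le> ennreal (V * (H (p i) - H (p (Suc i)))) * indicator {p i<..p (Suc i)} \<tau>"
          using i True by (simp add: ennreal_leI)
        also have "\<dots> \<le> (\<Sum>i<m. ennreal (V * (H (p i) - H (p (Suc i)))) * indicator {p i<..p (Suc i)} \<tau>)"
          by (rule member_le_sum) (use i in auto)
        finally show ?thesis .
      qed simp
    qed
  qed
  also have "\<dots> = (\<Sum>i<m. ennreal (V * (H (p i) - H (p (Suc i)))) * ennreal (t / real m))"
    using pS by (subst nn_integral_sum) (auto simp: nn_integral_cmult_indicator pstep)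
  also have "\<dots> = (\<Sum>i<m. ennreal (V * (H (p i) - H (p (Suc i))) * (t / real m)))"
    using V0 osc assms by (intro sum.cong refl) (auto simp: ennreal_mult'[symmetric])
  also have "\<dots> = ennreal (\<Sum>i<m. V * (H (p i) - H (p (Suc i))) * (t / real m))"
    using V0 osc assms by (intro sum_ennreal) auto
  also have "(\<Sum>i<m. V * (H (p i) - H (p (Suc i))) * (t / real m)) = V * (H 0 - H t) * (t / real m)"
    unfolding tele[symmetric] by (simp add: sum_distrib_left sum_distrib_right sum_divide_distrib)
  also have "\<dots> \<le> V * V * (t / real m)"
    using V V0 assms by (intro mult_right_mono mult_left_mono) auto
  finally show ?thesis using assms(1) by (simp add: power2_eq_square mult_ac ennreal_leI)
qed

text \<open>Summation by parts moves the differences from the path, which has no bounded variation,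
  to \<open>h\<close>, which has. The boundary term at \<open>t\<close> vanishes with
  \<open>h t\<close>; the one at 0 and the remaining sum contribute \<open>(H 0 - H t) * C\<close>
  each, hence the factor 2.\<close>

lemma step_integral_bound:
  fixes h H :: "real \<Rightarrow> real"
  assumes "mono p" "p 0 = 0" "p m = t" "h t = 0"
    and H: "\<And>u v. 0 \<le> u \<Longrightarrow> u \<le> v \<Longrightarrow> v \<le> t \<Longrightarrow> \<bar>h u - h v\<bar> \<le> H u - H v"
    and C: "\<And>r. r \<in> {0..t} \<Longrightarrow> \<bar>W r \<omega>\<bar> \<le> C"
  shows "\<bar>step_integral W p (\<lambda>i. h (p i)) m \<omega>\<bar> \<le> 2 * (H 0 - H t) * C"
proof -
  have pS: "p i \<le> p (Suc i)" for i using assms(1) by (simp add: mono_def)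
  have p: "0 \<le> p i" "i \<le> m \<Longrightarrow> p i \<le> t" for i
    using assms(1-3) by (auto simp: mono_def) (metis le0)
  have C0: "0 \<le> C" using C[of t] p(1)[of m] assms(3) abs_ge_zero[of "W t \<omega>"] by auto
  have tele: "(\<Sum>i<m. H (p i) - H (p (Suc i))) = H 0 - H t"
    using sum_lessThan_telescope'[of "\<lambda>i. H (p i)" m] assms(2,3) by simp
  have "step_integral W p (\<lambda>i. h (p i)) m \<omega>
      = h (p m) * W (p m) \<omega> - h (p 0) * W (p 0) \<omega> - (\<Sum>i<m. W (p (Suc i)) \<omega> * (h (p (Suc i)) - h (p i)))"
    unfolding step_integral_def using sum_by_parts[of "\<lambda>i. h (p i)" "\<lambda>i. W (p i) \<omega>" m] .
  then have "\<bar>step_integral W p (\<lambda>i. h (p i)) m \<omega>\<bar>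
      \<le> \<bar>h 0 * W 0 \<omega>\<bar> + \<bar>\<Sum>i<m. W (p (Suc i)) \<omega> * (h (p (Suc i)) - h (p i))\<bar>"
    using assms by auto
  \<comment> \<open>Since \<open>h t = 0\<close>, the value \<open>h 0\<close> is itself an
    increment of \<open>h\<close> over the whole interval.\<close>
  also have "\<bar>h 0 * W 0 \<omega>\<bar> \<le> (H 0 - H t) * C"
    using H[of 0 t] C[of 0] assms p(1)[of m] unfolding abs_mult by (intro mult_mono) auto
  also have "\<bar>\<Sum>i<m. W (p (Suc i)) \<omega> * (h (p (Suc i)) - h (p i))\<bar>
      \<le> (\<Sum>i<m. (H (p i) - H (p (Suc i))) * C)"
  proof (rule order.trans[OF sum_abs], rule sum_mono)
    fix i assume i: "i \<in> {..<m}"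
    have "\<bar>h (p (Suc i)) - h (p i)\<bar> \<le> H (p i) - H (p (Suc i))"
      using H[OF p(1)[of i] pS p(2)[of "Suc i"]] i by (simp add: abs_minus_commute)
    moreover have "\<bar>W (p (Suc i)) \<omega>\<bar> \<le> C"
      using i p by (intro C) auto
    ultimately have "\<bar>W (p (Suc i)) \<omega>\<bar> * \<bar>h (p (Suc i)) - h (p i)\<bar> \<le> C * (H (p i) - H (p (Suc i)))"
      using C0 by (intro mult_mono) auto
    then show "\<bar>W (p (Suc i)) \<omega> * (h (p (Suc i)) - h (p i))\<bar> \<le> (H (p i) - H (p (Suc i))) * C"
      by (simp add: abs_mult mult.commute)
  qed
  also have "\<dots> = (H 0 - H t) * C"
    by (simp add: sum_distrib_right[symmetric] tele)
  finally show ?thesis by (simp add: algebra_simps)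
qed

text \<open>The approximations hidden in the two integrals are arbitrary, so they are compared with
  the given step function through the isometry and then sent to their limits. The constant 9 arises
  from applying the three-term square inequality twice, once on each side of the isometry.\<close>

lemma wiener_integral_diff_L2:
  assumes W: "brownian_motion M W" and "0 \<le> t"
    and f: "has_wiener_integral M W t f I" and g: "has_wiener_integral M W t g J"
    and p: "mono p" "\<And>i. i \<le> m \<Longrightarrow> p i \<in> {0..t}"
  shows "(\<integral>\<^sup>+\<omega>. ennreal ((I \<omega> - J \<omega> - step_integral W p c m \<omega>)\<^sup>2) \<partial>M)
    \<le> 9 * (\<integral>\<^sup>+\<tau>\<in>{0..t}. ennreal ((f \<tau> - g \<tau> - step_fun p c m \<tau>)\<^sup>2) \<partial>lborel)"
proof -
  from f obtain pf cf mf where pf: "\<And>j. mono (pf j)" "\<And>j. range (pf j) \<subseteq> {0..t}"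
    and fl: "(\<lambda>j::nat. \<integral>\<^sup>+\<tau>\<in>{0..t}. ennreal ((f \<tau> - step_fun (pf j) (cf j) (mf j) \<tau>)\<^sup>2) \<partial>lborel) \<longlonglongrightarrow> 0"
    and Il: "(\<lambda>j::nat. \<integral>\<^sup>+\<omega>. ennreal ((I \<omega> - step_integral W (pf j) (cf j) (mf j) \<omega>)\<^sup>2) \<partial>M) \<longlonglongrightarrow> 0"
    unfolding has_wiener_integral_def by blast
  from g obtain pg cg mg where pg: "\<And>j. mono (pg j)" "\<And>j. range (pg j) \<subseteq> {0..t}"
    and gl: "(\<lambda>j::nat. \<integral>\<^sup>+\<tau>\<in>{0..t}. ennreal ((g \<tau> - step_fun (pg j) (cg j) (mg j) \<tau>)\<^sup>2) \<partial>lborel) \<longlonglongrightarrow> 0"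
    and Jl: "(\<lambda>j::nat. \<integral>\<^sup>+\<omega>. ennreal ((J \<omega> - step_integral W (pg j) (cg j) (mg j) \<omega>)\<^sup>2) \<partial>M) \<longlonglongrightarrow> 0"
    unfolding has_wiener_integral_def by blast
  define F where "F j = step_fun (pf j) (cf j) (mf j)" for j
  define G where "G j = step_fun (pg j) (cg j) (mg j)" for j
  define SF where "SF j = step_integral W (pf j) (cf j) (mf j)" for j
  define SG where "SG j = step_integral W (pg j) (cg j) (mg j)" for j
  define K where "K = step_fun p c m"
  define SK where "SK = step_integral W p c m"
  let ?i = "indicat_real {0..t}"
  have meas[measurable]: "F j \<in> borel_measurable borel" "G j \<in> borel_measurable borel"
    "K \<in> borel_measurable borel" for j
    unfolding F_def G_def K_def by measurable
  have Wm[measurable]: "W u \<in> borel_measurable M" if "0 \<le> u" for u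
    using W that unfolding brownian_motion_def by auto
  have pf0: "0 \<le> pf j i" and pg0: "0 \<le> pg j i" for j i
    using pf(2)[of j] pg(2)[of j] by (auto simp: image_subset_iff)
  have Smeas[measurable]: "SF j \<in> borel_measurable M" "SG j \<in> borel_measurable M" "SK \<in> borel_measurable M" for j
    unfolding SF_def SG_def SK_def step_integral_def[abs_def] using pf0 pg0 p(2)
    by (auto intro!: borel_measurable_sum borel_measurable_times borel_measurable_diff Wm)
  have IJ[measurable]: "I \<in> borel_measurable M" "J \<in> borel_measurable M"
    using f g unfolding has_wiener_integral_def by auto
  \<comment> \<open>\<open>f\<close> and \<open>g\<close> are known to be measurable on
    \<open>{0..t}\<close> only, so the estimates are made for their products with the
    indicator.\<close>
  have fg[measurable]: "(\<lambda>\<tau>. ?i \<tau> * f \<tau>) \<in> borel_measurable lborel" "(\<lambda>\<tau>. ?i \<tau> * g \<tau>) \<in> borel_measurable lborel"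
    using f g unfolding has_wiener_integral_def set_borel_measurable_def by auto
  have ii: "ennreal (x\<^sup>2) * indicator {0..t} \<tau> = ennreal ((?i \<tau> * x)\<^sup>2)" for x \<tau>
    by (auto simp: indicator_def)
  have iso: "(\<integral>\<^sup>+\<omega>. ennreal ((SF j \<omega> - SG j \<omega> - SK \<omega>)\<^sup>2) \<partial>M)
      = (\<integral>\<^sup>+\<tau>. ennreal ((F j \<tau> - G j \<tau> - K \<tau>)\<^sup>2) \<partial>lborel)" for j
  proof -
    \<comment> \<open>The three step integrals become one sum over pairs \<open>(r, i)\<close> with
      \<open>r < 3\<close>; the signs of the two subtracted ones go into the coefficients
      \<open>E\<close>.\<close>
    define P where "P r = [pf j, pg j, p] ! r" for r
    define N where "N r = [mf j, mg j, m] ! r" for r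
    define E where "E r = [cf j, (\<lambda>i. - cg j i), (\<lambda>i. - c i)] ! r" for r
    define A where "A = Sigma {..<3::nat} (\<lambda>r. {..<N r})"
    have ab: "0 \<le> P r i \<and> P r i \<le> P r (Suc i)" if "(r, i) \<in> A" for r i
    proof -
      have "r = 0 \<or> r = 1 \<or> r = 2" using that by (auto simp: A_def)
      then show ?thesis
        using that pf0 pg0 pf(1)[of j] pg(1)[of j] p by (auto simp: A_def P_def N_def mono_def)
    qed
    have Sig: "(\<Sum>x\<in>A. \<phi> (fst x) (snd x)) = (\<Sum>r<3. \<Sum>i<N r. \<phi> r i)" for \<phi> :: "nat \<Rightarrow> nat \<Rightarrow> real"
      unfolding A_def by (simp add: sum.Sigma split_def)
    have s1: "SF j \<omega> - SG j \<omega> - SK \<omega> = (\<Sum>x\<in>A. E (fst x) (snd x) *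
          (W (P (fst x) (Suc (snd x))) \<omega> - W (P (fst x) (snd x)) \<omega>))" for \<omega>
      unfolding SF_def SG_def SK_def step_integral_def
        Sig[of "\<lambda>r i. E r i * (W (P r (Suc i)) \<omega> - W (P r i) \<omega>)"]
      by (simp add: numeral_3_eq_3 P_def N_def E_def sum_negf)
    have s2: "F j \<tau> - G j \<tau> - K \<tau> = (\<Sum>x\<in>A. E (fst x) (snd x) *
          indicator {P (fst x) (snd x)<..P (fst x) (Suc (snd x))} \<tau>)" for \<tau>
      unfolding F_def G_def K_def step_fun_def
        Sig[of "\<lambda>r i. E r i * indicator {P r i<..P r (Suc i)} \<tau>"]
      by (simp add: numeral_3_eq_3 P_def N_def E_def sum_negf)
    show ?thesis
      unfolding s1 s2 by (rule wiener_isometry[OF W]) (use ab in \<open>auto simp: A_def\<close>)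
  qed
  have bnd: "(\<integral>\<^sup>+\<omega>. ennreal ((I \<omega> - J \<omega> - SK \<omega>)\<^sup>2) \<partial>M)
     \<le> 3 * (\<integral>\<^sup>+\<omega>. ennreal ((I \<omega> - SF j \<omega>)\<^sup>2) \<partial>M) + 3 * (\<integral>\<^sup>+\<omega>. ennreal ((J \<omega> - SG j \<omega>)\<^sup>2) \<partial>M)
      + 3 * (3 * (\<integral>\<^sup>+\<tau>\<in>{0..t}. ennreal ((f \<tau> - F j \<tau>)\<^sup>2) \<partial>lborel)
           + 3 * (\<integral>\<^sup>+\<tau>\<in>{0..t}. ennreal ((g \<tau> - G j \<tau>)\<^sup>2) \<partial>lborel)
           + 3 * (\<integral>\<^sup>+\<tau>\<in>{0..t}. ennreal ((f \<tau> - g \<tau> - K \<tau>)\<^sup>2) \<partial>lborel))" for j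
  proof -
    have "(\<integral>\<^sup>+\<tau>. ennreal ((F j \<tau> - G j \<tau> - K \<tau>)\<^sup>2) \<partial>lborel)
      = (\<integral>\<^sup>+\<tau>. ennreal (((?i \<tau> * F j \<tau> - ?i \<tau> * f \<tau>) + (?i \<tau> * g \<tau> - ?i \<tau> * G j \<tau>)
           + (?i \<tau> * f \<tau> - ?i \<tau> * g \<tau> - ?i \<tau> * K \<tau>))\<^sup>2) \<partial>lborel)"
    proof (rule nn_integral_cong)
      \<comment> \<open>Adding and subtracting \<open>f\<close> and \<open>g\<close> is harmless
        outside \<open>{0..t}\<close> too, since there all three step functions are 0.\<close>
      fix \<tau> :: real
      have "F j \<tau> - G j \<tau> - K \<tau> = (?i \<tau> * F j \<tau> - ?i \<tau> * f \<tau>) + (?i \<tau> * g \<tau> - ?i \<tau> * G j \<tau>)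
           + (?i \<tau> * f \<tau> - ?i \<tau> * g \<tau> - ?i \<tau> * K \<tau>)"
      proof (cases "\<tau> \<in> {0..t}")
        case False
        then have "F j \<tau> = 0" "G j \<tau> = 0" "K \<tau> = 0"
          unfolding F_def G_def K_def using pf(2)[of j] pg(2)[of j] p(2)
          by (intro step_fun_outside[of _ _ t]; auto simp: image_subset_iff)+
        then show ?thesis using False by simp
      qed simp
      then show "ennreal ((F j \<tau> - G j \<tau> - K \<tau>)\<^sup>2) = ennreal (((?i \<tau> * F j \<tau> - ?i \<tau> * f \<tau>) + (?i \<tau> * g \<tau> - ?i \<tau> * G j \<tau>)
           + (?i \<tau> * f \<tau> - ?i \<tau> * g \<tau> - ?i \<tau> * K \<tau>))\<^sup>2)"
        by (simp only:)
    qed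
    also have "\<dots> \<le> 3 * (\<integral>\<^sup>+\<tau>. ennreal ((?i \<tau> * F j \<tau> - ?i \<tau> * f \<tau>)\<^sup>2) \<partial>lborel)
        + 3 * (\<integral>\<^sup>+\<tau>. ennreal ((?i \<tau> * g \<tau> - ?i \<tau> * G j \<tau>)\<^sup>2) \<partial>lborel)
        + 3 * (\<integral>\<^sup>+\<tau>. ennreal ((?i \<tau> * f \<tau> - ?i \<tau> * g \<tau> - ?i \<tau> * K \<tau>)\<^sup>2) \<partial>lborel)"
      by (rule nn_integral_square_sum3_le) measurable
    also have "\<dots> = 3 * (\<integral>\<^sup>+\<tau>\<in>{0..t}. ennreal ((f \<tau> - F j \<tau>)\<^sup>2) \<partial>lborel)
           + 3 * (\<integral>\<^sup>+\<tau>\<in>{0..t}. ennreal ((g \<tau> - G j \<tau>)\<^sup>2) \<partial>lborel)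
           + 3 * (\<integral>\<^sup>+\<tau>\<in>{0..t}. ennreal ((f \<tau> - g \<tau> - K \<tau>)\<^sup>2) \<partial>lborel)"
      unfolding ii by (simp add: right_diff_distrib power2_commute)
    finally have 1: "(\<integral>\<^sup>+\<omega>. ennreal ((SF j \<omega> - SG j \<omega> - SK \<omega>)\<^sup>2) \<partial>M) \<le> \<dots>"
      unfolding iso .
    have "(\<integral>\<^sup>+\<omega>. ennreal ((I \<omega> - J \<omega> - SK \<omega>)\<^sup>2) \<partial>M)
      = (\<integral>\<^sup>+\<omega>. ennreal (((I \<omega> - SF j \<omega>) + (SG j \<omega> - J \<omega>) + (SF j \<omega> - SG j \<omega> - SK \<omega>))\<^sup>2) \<partial>M)"
      by (simp add: algebra_simps)
    also have "\<dots> \<le> 3 * (\<integral>\<^sup>+\<omega>. ennreal ((I \<omega> - SF j \<omega>)\<^sup>2) \<partial>M) + 3 * (\<integral>\<^sup>+\<omega>. ennreal ((SG j \<omega> - J \<omega>)\<^sup>2) \<partial>M)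
        + 3 * (\<integral>\<^sup>+\<omega>. ennreal ((SF j \<omega> - SG j \<omega> - SK \<omega>)\<^sup>2) \<partial>M)"
      by (rule nn_integral_square_sum3_le) measurable
    also have "\<dots> \<le> 3 * (\<integral>\<^sup>+\<omega>. ennreal ((I \<omega> - SF j \<omega>)\<^sup>2) \<partial>M) + 3 * (\<integral>\<^sup>+\<omega>. ennreal ((SG j \<omega> - J \<omega>)\<^sup>2) \<partial>M)
        + 3 * (3 * (\<integral>\<^sup>+\<tau>\<in>{0..t}. ennreal ((f \<tau> - F j \<tau>)\<^sup>2) \<partial>lborel)
           + 3 * (\<integral>\<^sup>+\<tau>\<in>{0..t}. ennreal ((g \<tau> - G j \<tau>)\<^sup>2) \<partial>lborel)
           + 3 * (\<integral>\<^sup>+\<tau>\<in>{0..t}. ennreal ((f \<tau> - g \<tau> - K \<tau>)\<^sup>2) \<partial>lborel))"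
      using 1 by (intro add_left_mono mult_left_mono) auto
    finally show ?thesis
      by (simp only: power2_commute[of "SG j _"])
  qed
  have "(\<lambda>j. 3 * (\<integral>\<^sup>+\<omega>. ennreal ((I \<omega> - SF j \<omega>)\<^sup>2) \<partial>M) + 3 * (\<integral>\<^sup>+\<omega>. ennreal ((J \<omega> - SG j \<omega>)\<^sup>2) \<partial>M)
      + 3 * (3 * (\<integral>\<^sup>+\<tau>\<in>{0..t}. ennreal ((f \<tau> - F j \<tau>)\<^sup>2) \<partial>lborel)
           + 3 * (\<integral>\<^sup>+\<tau>\<in>{0..t}. ennreal ((g \<tau> - G j \<tau>)\<^sup>2) \<partial>lborel)
           + 3 * (\<integral>\<^sup>+\<tau>\<in>{0..t}. ennreal ((f \<tau> - g \<tau> - K \<tau>)\<^sup>2) \<partial>lborel)))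
     \<longlonglongrightarrow> 3 * 0 + 3 * 0 + 3 * (3 * 0 + 3 * 0 + 3 * (\<integral>\<^sup>+\<tau>\<in>{0..t}. ennreal ((f \<tau> - g \<tau> - K \<tau>)\<^sup>2) \<partial>lborel))"
    using fl gl Il Jl unfolding F_def G_def SF_def SG_def
    by (intro tendsto_add ennreal_tendsto_cmult tendsto_const) auto
  from LIMSEQ_le_const[OF this] bnd
  have "(\<integral>\<^sup>+\<omega>. ennreal ((I \<omega> - J \<omega> - SK \<omega>)\<^sup>2) \<partial>M)
     \<le> 3 * (3 * (\<integral>\<^sup>+\<tau>\<in>{0..t}. ennreal ((f \<tau> - g \<tau> - K \<tau>)\<^sup>2) \<partial>lborel))"
    by auto
  then show ?thesis unfolding K_def SK_def by (simp add: mult.assoc[symmetric])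
qed

text \<open>Summation by parts bounds the integral pathwise, so no maximal inequality is needed.\<close>

lemma wiener_integral_diff_bound:
  assumes W: "brownian_motion M W" and t: "0 \<le> t"
    and f: "has_wiener_integral M W t f I" and g: "has_wiener_integral M W t g J"
    and ft: "f t = g t"
    and H: "\<And>u v. 0 \<le> u \<Longrightarrow> u \<le> v \<Longrightarrow> v \<le> t \<Longrightarrow> \<bar>(f u - g u) - (f v - g v)\<bar> \<le> H u - H v"
  shows "AE \<omega> in M. \<forall>C. (\<forall>r\<in>{0..t}. \<bar>W r \<omega>\<bar> \<le> C) \<longrightarrow> \<bar>I \<omega> - J \<omega>\<bar> \<le> 2 * (H 0 - H t) * C"
proof -
  define h where "h \<tau> = f \<tau> - g \<tau>" for \<tau>
  \<comment> \<open>Taking (k+1)^2 cells makes the squared L^2 errors summable in \<open>k\<close>,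
    so the Riemann sums converge almost surely.\<close>
  define p where "p k i = t * real i / real ((Suc k)\<^sup>2)" for k i
  define S where "S k = step_integral W (p k) (\<lambda>i. h (p k i)) ((Suc k)\<^sup>2)" for k
  define V where "V = H 0 - H t"
  have pk: "mono (p k)" "p k 0 = 0" "p k ((Suc k)\<^sup>2) = t" "0 \<le> p k i" for k i
    unfolding p_def using t by (auto intro!: monoI divide_right_mono mult_left_mono simp del: of_nat_Suc of_nat_power)
  have pk2: "p k i \<in> {0..t}" if "i \<le> (Suc k)\<^sup>2" for k i
    using monoD[OF pk(1)[of k] that] pk(3)[of k] pk(4)[of k i] by simp
  have [measurable]: "W u \<in> borel_measurable M" if "0 \<le> u" for u
    using W that unfolding brownian_motion_def by auto
  have Sm[measurable]: "S k \<in> borel_measurable M" for k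
    unfolding S_def step_integral_def[abs_def] using pk(4)
    by (auto intro!: borel_measurable_sum borel_measurable_times borel_measurable_diff)
  have IJ[measurable]: "I \<in> borel_measurable M" "J \<in> borel_measurable M"
    using f g unfolding has_wiener_integral_def by auto
  have "AE \<omega> in M. (\<lambda>k. I \<omega> - J \<omega> - S k \<omega>) \<longlonglongrightarrow> 0"
  proof (rule AE_tendsto_zero_if_summable_L2)
    show "(\<lambda>\<omega>. I \<omega> - J \<omega> - S k \<omega>) \<in> borel_measurable M" for k by measurable
    show "summable (\<lambda>k. 9 * (t * V\<^sup>2 / real ((Suc k)\<^sup>2)))"
      using summable_mult[OF summable_inverse_Suc_square, of "9 * (t * V\<^sup>2)"] by (simp add: divide_inverse mult.assoc)
    show "0 \<le> 9 * (t * V\<^sup>2 / real ((Suc k)\<^sup>2))" for k using t by simp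
    fix k
    have "(\<integral>\<^sup>+\<omega>. ennreal ((I \<omega> - J \<omega> - S k \<omega>)\<^sup>2) \<partial>M)
      \<le> 9 * (\<integral>\<^sup>+\<tau>\<in>{0..t}. ennreal ((f \<tau> - g \<tau> - step_fun (p k) (\<lambda>i. h (p k i)) ((Suc k)\<^sup>2) \<tau>)\<^sup>2) \<partial>lborel)"
      unfolding S_def by (rule wiener_integral_diff_L2[OF W t f g pk(1) pk2])
    also have "\<dots> \<le> 9 * ennreal (t * V\<^sup>2 / real ((Suc k)\<^sup>2))"
      using uniform_step_approximation[OF t, of "(Suc k)\<^sup>2" h H V] H unfolding h_def V_def p_def
      by (intro mult_left_mono) simp_all
    also have "\<dots> = ennreal (9 * (t * V\<^sup>2 / real ((Suc k)\<^sup>2)))"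
      by (subst ennreal_mult') auto
    finally show "(\<integral>\<^sup>+\<omega>. ennreal ((I \<omega> - J \<omega> - S k \<omega>)\<^sup>2) \<partial>M) \<le> ennreal (9 * (t * V\<^sup>2 / real ((Suc k)\<^sup>2)))" .
  qed
  then show ?thesis
  proof eventually_elim
    case (elim \<omega>)
    show ?case
    proof (intro allI impI)
      \<comment> \<open>The null set was chosen before \<open>C\<close>, so \<open>C\<close> may
        depend on the path; this is what allows the supremum of |W| to be used later.\<close>
      fix C assume C: "\<forall>r\<in>{0..t}. \<bar>W r \<omega>\<bar> \<le> C"
      have "(\<lambda>k. I \<omega> - J \<omega> - (I \<omega> - J \<omega> - S k \<omega>)) \<longlonglongrightarrow> I \<omega> - J \<omega> - 0"
        by (intro tendsto_diff tendsto_const elim)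
      then have "(\<lambda>k. \<bar>S k \<omega>\<bar>) \<longlonglongrightarrow> \<bar>I \<omega> - J \<omega>\<bar>"
        by (intro tendsto_rabs) simp
      moreover have "\<bar>S k \<omega>\<bar> \<le> 2 * V * C" for k
        unfolding S_def V_def
        by (rule step_integral_bound[OF pk(1-3)]) (use ft H C in \<open>auto simp: h_def\<close>)
      ultimately show "\<bar>I \<omega> - J \<omega>\<bar> \<le> 2 * (H 0 - H t) * C"
        unfolding V_def by (auto intro: LIMSEQ_le_const2)
    qed
  qed
qed

subsection \<open>A strong law of large numbers for square-integrable nonnegative variables\<close>

lemma (in prob_space) uncorrelated_sum_variance:
  fixes X :: "nat \<Rightarrow> 'a \<Rightarrow> real"
  assumes int: "\<And>i. integrable M (X i)" "\<And>i. integrable M (\<lambda>\<omega>. (X i \<omega>)\<^sup>2)"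
    and mean: "\<And>i. expectation (X i) = m" and second: "\<And>i. expectation (\<lambda>\<omega>. (X i \<omega>)\<^sup>2) = v"
    and pair: "\<And>i j. i \<noteq> j \<Longrightarrow> integrable M (\<lambda>\<omega>. X i \<omega> * X j \<omega>)"
      "\<And>i j. i \<noteq> j \<Longrightarrow> expectation (\<lambda>\<omega>. X i \<omega> * X j \<omega>) = m * m"
  shows "(\<integral>\<^sup>+\<omega>. ennreal (((\<Sum>i<n. X i \<omega>) - real n * m)\<^sup>2) \<partial>M) \<le> ennreal (real n * v)"
proof -
  have pi: "integrable M (\<lambda>\<omega>. X i \<omega> * X j \<omega>)" for i j
    using pair(1)[of i j] int(2)[of i] by (cases "i = j") (auto simp: power2_eq_square)
  have E: "expectation (\<lambda>\<omega>. X i \<omega> * X j \<omega>) = m * m + (if i = j then v - m * m else 0)" for i j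
    using pair(2)[of i j] second[of i] by (auto simp: power2_eq_square)
  have sq: "((\<Sum>i<n. X i \<omega>) - real n * m)\<^sup>2 =
      (\<Sum>i<n. \<Sum>j<n. X i \<omega> * X j \<omega>) - 2 * real n * m * (\<Sum>i<n. X i \<omega>) + (real n * m)\<^sup>2" for \<omega>
    by (simp add: power2_eq_square sum_product[symmetric] algebra_simps)
  have I: "integrable M (\<lambda>\<omega>. ((\<Sum>i<n. X i \<omega>) - real n * m)\<^sup>2)"
    unfolding sq using pi int by auto
  have "(\<integral>\<^sup>+\<omega>. ennreal (((\<Sum>i<n. X i \<omega>) - real n * m)\<^sup>2) \<partial>M)
      = ennreal (expectation (\<lambda>\<omega>. ((\<Sum>i<n. X i \<omega>) - real n * m)\<^sup>2))"
    by (rule nn_integral_eq_integral[OF I]) simp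
  also have "expectation (\<lambda>\<omega>. ((\<Sum>i<n. X i \<omega>) - real n * m)\<^sup>2)
      = (\<Sum>i<n. \<Sum>j<n. m * m + (if i = j then v - m * m else 0)) - 2 * real n * m * (real n * m) + (real n * m)\<^sup>2"
    unfolding sq using pi int
    by (simp add: Bochner_Integration.integral_sum E mean prob_space)
  also have "\<dots> = real n * (v - m * m)"
    by (simp add: sum.distrib power2_eq_square algebra_simps)
  also have "\<dots> \<le> real n * v"
    by (simp add: mult_left_mono)
  finally show ?thesis by (simp add: ennreal_leI)
qed

text \<open>For nonnegative terms the partial sums increase, so an average is squeezed between the
  partial sums at the two neighbouring squares, each divided by the other square. The ratio of
  consecutive squares tends to 1.\<close>

lemma averages_interpolate_squares:
  fixes x :: "nat \<Rightarrow> real"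
  assumes nn: "\<And>i. 0 \<le> x i"
    and lim: "(\<lambda>q. (\<Sum>i<(Suc q)\<^sup>2. x i) / real ((Suc q)\<^sup>2)) \<longlonglongrightarrow> m"
  shows "(\<lambda>n. (\<Sum>i<Suc n. x i) / real (Suc n)) \<longlonglongrightarrow> m"
proof -
  define S where "S n = (\<Sum>i<n. x i)" for n
  \<comment> \<open>Chosen so that (q+1)^2 \<le> n+1 \<le> (q+2)^2; the subtraction does not
    truncate because the root is at least 1.\<close>
  define q where "q n = floor_sqrt (Suc n) - 1" for n
  have Smono: "S a \<le> S b" if "a \<le> b" for a b
    unfolding S_def using that nn by (intro sum_mono2) auto
  have S0: "0 \<le> S n" for n unfolding S_def using nn by (intro sum_nonneg) auto
  have q1: "Suc (q n) = floor_sqrt (Suc n)" for n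
    using floor_sqrt_greater_zero_iff[of "Suc n"] unfolding q_def by linarith
  have qle: "(Suc (q n))\<^sup>2 \<le> Suc n" for n
    unfolding q1 by simp
  have qgt: "Suc n \<le> (Suc (Suc (q n)))\<^sup>2" for n
    unfolding q1 using Suc_floor_sqrt_power2_gt[of "Suc n"] by simp
  have qinf: "filterlim q at_top sequentially"
    unfolding filterlim_at_top
  proof
    fix Z
    have "Z \<le> q n" if "n \<ge> (Suc Z)\<^sup>2" for n
    proof -
      have "Suc Z = floor_sqrt ((Suc Z)\<^sup>2)" by simp
      also have "\<dots> \<le> floor_sqrt (Suc n)" by (rule mono_floor_sqrt') (use that in simp)
      finally show ?thesis using q1[of n] by simp
    qed
    then show "\<forall>\<^sub>F n in sequentially. Z \<le> q n"
      by (rule eventually_sequentiallyI)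
  qed
  have r: "(\<lambda>q. (real (Suc (Suc q)) / real (Suc q))\<^sup>2) \<longlonglongrightarrow> 1"
    by real_asymp
  have r': "(\<lambda>q. (real (Suc q) / real (Suc (Suc q)))\<^sup>2) \<longlonglongrightarrow> 1"
    by real_asymp
  have L: "(\<lambda>q. S ((Suc q)\<^sup>2) / real ((Suc q)\<^sup>2)) \<longlonglongrightarrow> m"
    using lim by (simp add: S_def)
  have lo: "(\<lambda>q. S ((Suc q)\<^sup>2) / real ((Suc q)\<^sup>2) * (real (Suc q) / real (Suc (Suc q)))\<^sup>2) \<longlonglongrightarrow> m"
    using tendsto_mult[OF L r'] by simp
  have hi: "(\<lambda>q. S ((Suc (Suc q))\<^sup>2) / real ((Suc (Suc q))\<^sup>2) * (real (Suc (Suc q)) / real (Suc q))\<^sup>2) \<longlonglongrightarrow> m"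
    using tendsto_mult[OF LIMSEQ_Suc[OF L] r] by simp
  have lo_eq: "S ((Suc q)\<^sup>2) / real ((Suc q)\<^sup>2) * (real (Suc q) / real (Suc (Suc q)))\<^sup>2
      = S ((Suc q)\<^sup>2) / real ((Suc (Suc q))\<^sup>2)" for q
    by (simp add: power_divide del: of_nat_Suc)
  have hi_eq: "S ((Suc (Suc q))\<^sup>2) / real ((Suc (Suc q))\<^sup>2) * (real (Suc (Suc q)) / real (Suc q))\<^sup>2
      = S ((Suc (Suc q))\<^sup>2) / real ((Suc q)\<^sup>2)" for q
    by (simp add: power_divide del: of_nat_Suc)
  have "(\<lambda>n. S (Suc n) / real (Suc n)) \<longlonglongrightarrow> m"
  proof (rule tendsto_sandwich)
    show "(\<lambda>n. S ((Suc (q n))\<^sup>2) / real ((Suc (Suc (q n)))\<^sup>2)) \<longlonglongrightarrow> m"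
      using filterlim_compose[OF lo qinf] unfolding lo_eq .
    show "(\<lambda>n. S ((Suc (Suc (q n)))\<^sup>2) / real ((Suc (q n))\<^sup>2)) \<longlonglongrightarrow> m"
      using filterlim_compose[OF hi qinf] unfolding hi_eq .
    have "S ((Suc (q n))\<^sup>2) / real ((Suc (Suc (q n)))\<^sup>2) \<le> S (Suc n) / real (Suc n)" for n
      by (rule frac_le[OF S0 Smono[OF qle]]) (use qgt[of n] in \<open>simp_all only: of_nat_le_iff of_nat_0_less_iff zero_less_Suc\<close>)
    then show "\<forall>\<^sub>F n in sequentially. S ((Suc (q n))\<^sup>2) / real ((Suc (Suc (q n)))\<^sup>2) \<le> S (Suc n) / real (Suc n)"
      by simp
    have "S (Suc n) / real (Suc n) \<le> S ((Suc (Suc (q n)))\<^sup>2) / real ((Suc (q n))\<^sup>2)" for n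
      by (rule frac_le[OF S0 Smono[OF qgt]]) (use qle[of n] in \<open>simp_all only: of_nat_le_iff of_nat_0_less_iff zero_less_power zero_less_Suc\<close>)
    then show "\<forall>\<^sub>F n in sequentially. S (Suc n) / real (Suc n) \<le> S ((Suc (Suc (q n)))\<^sup>2) / real ((Suc (q n))\<^sup>2)"
      by simp
  qed
  then show ?thesis by (simp add: S_def)
qed

text \<open>The average over (q+1)^2 terms has variance at most v/(q+1)^2, which is summable, so the
  averages converge along the squares; nonnegativity fills the gaps between them.\<close>

lemma (in prob_space) strong_law_uncorrelated_nonneg:
  fixes X :: "nat \<Rightarrow> 'a \<Rightarrow> real"
  assumes int: "\<And>i. integrable M (X i)" "\<And>i. integrable M (\<lambda>\<omega>. (X i \<omega>)\<^sup>2)"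
    and mean: "\<And>i. expectation (X i) = m" and second: "\<And>i. expectation (\<lambda>\<omega>. (X i \<omega>)\<^sup>2) = v"
    and pair: "\<And>i j. i \<noteq> j \<Longrightarrow> integrable M (\<lambda>\<omega>. X i \<omega> * X j \<omega>)"
      "\<And>i j. i \<noteq> j \<Longrightarrow> expectation (\<lambda>\<omega>. X i \<omega> * X j \<omega>) = m * m"
    and nn: "\<And>i. AE \<omega> in M. 0 \<le> X i \<omega>"
  shows "AE \<omega> in M. (\<lambda>n. (\<Sum>i<Suc n. X i \<omega>) / real (Suc n)) \<longlonglongrightarrow> m"
proof -
  have [measurable]: "X i \<in> borel_measurable M" for i using int by auto
  define D where "D q \<omega> = (\<Sum>i<(Suc q)\<^sup>2. X i \<omega>) / real ((Suc q)\<^sup>2) - m" for q \<omega>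
  have v0: "0 \<le> v" unfolding second[of 0, symmetric] by simp
  have "AE \<omega> in M. (\<lambda>q. D q \<omega>) \<longlonglongrightarrow> 0"
  proof (rule AE_tendsto_zero_if_summable_L2)
    show "D q \<in> borel_measurable M" for q unfolding D_def by measurable
    show "summable (\<lambda>q. v / real (Suc q) ^ 2)"
      using summable_mult[OF summable_inverse_Suc_square, of v] by (simp add: divide_inverse)
    show "0 \<le> v / real (Suc q) ^ 2" for q using v0 by simp
    fix q
    let ?n = "(Suc q)\<^sup>2"
    have n: "real ?n > 0" by simp
    have "(\<integral>\<^sup>+\<omega>. ennreal ((D q \<omega>)\<^sup>2) \<partial>M)
        = (\<integral>\<^sup>+\<omega>. ennreal (1 / (real ?n)\<^sup>2) * ennreal (((\<Sum>i<?n. X i \<omega>) - real ?n * m)\<^sup>2) \<partial>M)"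
    proof (rule nn_integral_cong)
      fix \<omega>
      have "D q \<omega> = ((\<Sum>i<?n. X i \<omega>) - real ?n * m) / real ?n"
        unfolding D_def using n by (simp add: diff_divide_distrib del: of_nat_Suc of_nat_power)
      then have "(D q \<omega>)\<^sup>2 = 1 / (real ?n)\<^sup>2 * ((\<Sum>i<?n. X i \<omega>) - real ?n * m)\<^sup>2"
        by (simp add: power_divide del: of_nat_Suc of_nat_power)
      then show "ennreal ((D q \<omega>)\<^sup>2) = ennreal (1 / (real ?n)\<^sup>2) * ennreal (((\<Sum>i<?n. X i \<omega>) - real ?n * m)\<^sup>2)"
        by (simp add: ennreal_mult'[symmetric] del: of_nat_Suc of_nat_power)
    qed
    also have "\<dots> = ennreal (1 / (real ?n)\<^sup>2) * (\<integral>\<^sup>+\<omega>. ennreal (((\<Sum>i<?n. X i \<omega>) - real ?n * m)\<^sup>2) \<partial>M)"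
      by (rule nn_integral_cmult) measurable
    also have "\<dots> \<le> ennreal (1 / (real ?n)\<^sup>2) * ennreal (real ?n * v)"
      by (intro mult_left_mono uncorrelated_sum_variance int mean second pair) auto
    also have "\<dots> = ennreal (1 / (real ?n)\<^sup>2 * (real ?n * v))"
      using v0 by (subst ennreal_mult') auto
    also have "1 / (real ?n)\<^sup>2 * (real ?n * v) = v / real ?n"
      using n by (simp add: power2_eq_square[of "real ?n"] del: of_nat_Suc of_nat_power)
    also have "v / real ?n = v / real (Suc q) ^ 2"
      by (simp only: of_nat_power)
    finally show "(\<integral>\<^sup>+\<omega>. ennreal ((D q \<omega>)\<^sup>2) \<partial>M) \<le> ennreal (v / real (Suc q) ^ 2)" .
  qed
  moreover have "AE \<omega> in M. \<forall>i. 0 \<le> X i \<omega>"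
    using nn by (subst AE_all_countable) auto
  ultimately show ?thesis
  proof eventually_elim
    case (elim \<omega>)
    then have "(\<lambda>q. (\<Sum>i<(Suc q)\<^sup>2. X i \<omega>) / real ((Suc q)\<^sup>2)) \<longlonglongrightarrow> m"
      unfolding D_def by (simp add: LIM_zero_iff)
    then show ?case
      using elim by (intro averages_interpolate_squares) auto
  qed
qed

subsection \<open>Moments of the Gamma distribution\<close>

lemma (in prob_space) strong_law_indep_image:
  fixes \<alpha> :: "nat \<Rightarrow> 'a \<Rightarrow> real" and g :: "real \<Rightarrow> real"
  assumes ind: "indep_vars (\<lambda>_. borel) \<alpha> {1..}" and g[measurable]: "g \<in> borel_measurable borel"
    and int: "\<And>k. k \<ge> 1 \<Longrightarrow> integrable M (\<lambda>\<omega>. g (\<alpha> k \<omega>))"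
      "\<And>k. k \<ge> 1 \<Longrightarrow> integrable M (\<lambda>\<omega>. (g (\<alpha> k \<omega>))\<^sup>2)"
    and mean: "\<And>k. k \<ge> 1 \<Longrightarrow> expectation (\<lambda>\<omega>. g (\<alpha> k \<omega>)) = m"
    and second: "\<And>k. k \<ge> 1 \<Longrightarrow> expectation (\<lambda>\<omega>. (g (\<alpha> k \<omega>))\<^sup>2) = v"
    and nn: "\<And>k. k \<ge> 1 \<Longrightarrow> AE \<omega> in M. 0 \<le> g (\<alpha> k \<omega>)"
  shows "AE \<omega> in M. (\<lambda>n. (\<Sum>i<Suc n. g (\<alpha> (Suc i) \<omega>)) / real (Suc n)) \<longlonglongrightarrow> m"
proof (rule strong_law_uncorrelated_nonneg)
  fix i j :: nat assume "i \<noteq> j"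
  \<comment> \<open>Restricting the independent family to two indices turns the product rule into
    the factorization of one mixed moment.\<close>
  let ?I = "{Suc i, Suc j}"
  have I: "indep_vars (\<lambda>_. borel) (\<lambda>k \<omega>. g (\<alpha> k \<omega>)) ?I"
    by (rule indep_vars_compose2[OF indep_vars_subset[OF ind]]) auto
  have i: "integrable M (\<lambda>\<omega>. g (\<alpha> k \<omega>))" if "k \<in> ?I" for k
    using that by (auto intro: int)
  show "integrable M (\<lambda>\<omega>. g (\<alpha> (Suc i) \<omega>) * g (\<alpha> (Suc j) \<omega>))"
    using indep_vars_integrable[OF _ I i] \<open>i \<noteq> j\<close> by simp
  show "expectation (\<lambda>\<omega>. g (\<alpha> (Suc i) \<omega>) * g (\<alpha> (Suc j) \<omega>)) = m * m"
    using indep_vars_lebesgue_integral[OF _ I i] \<open>i \<noteq> j\<close> by (simp add: mean)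
qed (use assms in auto)

section \<open>Integrals against the Gamma density\<close>

text \<open>Euler's integral after rescaling the variable by \<open>b\<close>. The half-line is open
  to match \<open>gamma_density\<close>; it differs from the closed one by a null set.\<close>

lemma has_bochner_integral_powr_exp:
  fixes a b :: real
  assumes "0 < a" "0 < b"
  shows "has_bochner_integral lborel (\<lambda>x. indicator {0<..} x * (x powr (a - 1) * exp (- b * x))) (Gamma a / b powr a)"
proof -
  have G: "has_bochner_integral lborel (\<lambda>x. indicator {0<..} x * (x powr (a - 1) * exp (- x))) (Gamma a)"
  proof (rule has_bochner_integral_nn_integral)
    have "(\<integral>\<^sup>+x. ennreal (indicator {0<..} x * (x powr (a - 1) * exp (- x))) \<partial>lborel)
        = (\<integral>\<^sup>+x. ennreal (indicator {0..} x * x powr (a - 1) / exp x) \<partial>lborel)"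
    proof (rule nn_integral_cong_AE)
      have "AE x in lborel. x \<noteq> (0::real)" by (rule AE_lborel_singleton)
      then show "AE x in lborel. ennreal (indicator {0<..} x * (x powr (a - 1) * exp (- x)))
          = ennreal (indicator {0..} x * x powr (a - 1) / exp x)"
        by eventually_elim (auto simp: indicator_def exp_minus divide_inverse)
    qed
    then show "(\<integral>\<^sup>+x. ennreal (indicator {0<..} x * (x powr (a - 1) * exp (- x))) \<partial>lborel) = ennreal (Gamma a)"
      using Gamma_conv_nn_integral_real[OF assms(1)] by simp
  qed (use assms Gamma_real_pos[of a] in auto)
  have "has_bochner_integral lborel (\<lambda>x. indicator {0<..} (0 + b * x) * ((0 + b * x) powr (a - 1) * exp (- (0 + b * x)))) (Gamma a / \<bar>b\<bar>)"
    using G lborel_has_bochner_integral_real_affine_iff[of b _ "Gamma a" 0] assms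
    by (simp add: divide_inverse mult.commute)
  \<comment> \<open>This factor undoes the power of \<open>b\<close> that the rescaling puts into
    \<open>(b * x) powr (a - 1)\<close>.\<close>
  from has_bochner_integral_mult_right[OF this, of "b powr (1 - a)"]
  have "has_bochner_integral lborel (\<lambda>x. b powr (1 - a) * (indicator {0<..} (b * x) * ((b * x) powr (a - 1) * exp (- (b * x)))))
      (b powr (1 - a) * (Gamma a / b))"
    using assms by simp
  moreover have "b powr (1 - a) * (indicator {0<..} (b * x) * ((b * x) powr (a - 1) * exp (- (b * x))))
      = indicator {0<..} x * (x powr (a - 1) * exp (- b * x))" for x
  proof (cases "0 < x")
    case True
    then have "b powr (1 - a) * (b * x) powr (a - 1) = x powr (a - 1)"
      using assms by (simp add: powr_mult powr_add[symmetric] mult.assoc[symmetric])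
    then show ?thesis using True assms by (simp add: mult.assoc[symmetric])
  next
    case False
    then show ?thesis using assms by (simp add: indicator_def zero_less_mult_iff)
  qed
  moreover have "b powr (1 - a) * (Gamma a / b) = Gamma a / b powr a"
    using assms by (simp add: powr_diff)
  ultimately show ?thesis by simp
qed

lemma gamma_density_nonneg: "0 < \<mu> \<Longrightarrow> 0 < l \<Longrightarrow> 0 \<le> gamma_density \<mu> l x"
  unfolding gamma_density_def using Gamma_real_pos[of \<mu>] by simp

lemma gamma_density_eq:
  assumes "0 < l"
  shows "gamma_density \<mu> l x = l powr \<mu> / Gamma \<mu> * (indicator {0<..} x * (x powr (\<mu> - 1) * exp (- l * x)))"
proof (cases "0 < x")
  case True
  have "l * l powr (\<mu> - 1) = l powr \<mu>" using assms by (simp add: powr_diff)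
  then show ?thesis using True assms by (simp add: gamma_density_def powr_mult)
qed (simp add: gamma_density_def)

text \<open>The factor \<open>x ^ j\<close> shifts the shape from \<mu> to \<mu> + j, and the
  quotient of the two Gamma values is the Pochhammer symbol. These are the coefficients in
  \<open>G_fun\<close>.\<close>

lemma gamma_density_moment:
  assumes "0 < \<mu>" "0 < l"
  shows "has_bochner_integral lborel (\<lambda>x. gamma_density \<mu> l x * x ^ j) (pochhammer \<mu> j / l ^ j)"
proof -
  have "\<mu> \<notin> \<int>\<^sub>\<le>\<^sub>0" using assms by (auto elim!: nonpos_Ints_cases)
  then have "l powr \<mu> / Gamma \<mu> * (Gamma (\<mu> + real j) / l powr (\<mu> + real j)) = pochhammer \<mu> j / l ^ j"
    using assms by (simp add: pochhammer_Gamma powr_add powr_realpow)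
  moreover have "gamma_density \<mu> l x * x ^ j
      = l powr \<mu> / Gamma \<mu> * (indicator {0<..} x * (x powr (\<mu> + real j - 1) * exp (- l * x)))" for x
  proof (cases "0 < x")
    case True
    have "x powr (\<mu> + real j - 1) = x powr (\<mu> - 1) * x ^ j"
      using True by (simp add: powr_add[symmetric] powr_realpow[symmetric] algebra_simps)
    then show ?thesis using True by (simp add: gamma_density_eq[OF assms(2)])
  qed (simp add: gamma_density_def)
  ultimately show ?thesis
    using has_bochner_integral_mult_right[OF has_bochner_integral_powr_exp[of "\<mu> + real j" l], of "l powr \<mu> / Gamma \<mu>"] assms
    by simp
qed

text \<open>The exponential factor shifts the rate from \<open>l\<close> to \<open>l - e\<close>,
  which must stay positive.\<close>

lemma gamma_density_exp_moment:
  assumes "0 < \<mu>" "e < l" "0 < l"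
  shows "has_bochner_integral lborel (\<lambda>x. gamma_density \<mu> l x * exp (e * x)) ((l / (l - e)) powr \<mu>)"
proof -
  have "Gamma \<mu> \<noteq> 0" using Gamma_real_pos[OF assms(1)] by linarith
  then have "l powr \<mu> / Gamma \<mu> * (Gamma \<mu> / (l - e) powr \<mu>) = (l / (l - e)) powr \<mu>"
    using assms by (simp add: powr_divide)
  moreover have "gamma_density \<mu> l x * exp (e * x)
      = l powr \<mu> / Gamma \<mu> * (indicator {0<..} x * (x powr (\<mu> - 1) * exp (- (l - e) * x)))" for x
    by (simp add: gamma_density_eq[OF assms(3)] mult_exp_exp algebra_simps)
  ultimately show ?thesis
    using has_bochner_integral_mult_right[OF has_bochner_integral_powr_exp[of \<mu> "l - e"], of "l powr \<mu> / Gamma \<mu>"] assms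
    by simp
qed

lemma distributed_has_bochner_integral:
  fixes f g :: "real \<Rightarrow> real"
  assumes D: "distributed N lborel X (\<lambda>x. ennreal (f x))" and f: "\<And>x. 0 \<le> f x"
    and g: "g \<in> borel_measurable borel"
    and I: "has_bochner_integral lborel (\<lambda>x. f x * g x) r"
  shows "has_bochner_integral N (\<lambda>\<omega>. g (X \<omega>)) r"
  using I distributed_integrable[OF D _ f, of g] distributed_integral[OF D _ f, of g] g
  by (simp add: has_bochner_integral_iff)

context
  fixes N :: "'b measure" and \<alpha> :: "nat \<Rightarrow> 'b \<Rightarrow> real" and \<mu> l :: real
  assumes N: "prob_space N" and pos: "0 < \<mu>" "0 < l"
    and ind: "prob_space.indep_vars N (\<lambda>_. borel) \<alpha> {1..}"
    and dist: "\<And>k. k \<ge> 1 \<Longrightarrow> distributed N lborel (\<alpha> k) (\<lambda>x. ennreal (gamma_density \<mu> l x))"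
begin

lemma gamma_samples_nonneg: "AE \<omega> in N. \<forall>k. 0 \<le> \<alpha> (Suc k) \<omega>"
proof -
  have "AE \<omega> in N. 0 \<le> \<alpha> (Suc k) \<omega>" for k
    by (subst prob_space.distributed_AE2[OF N dist]) (auto simp: gamma_density_def)
  then show ?thesis by (subst AE_all_countable) blast
qed

text \<open>Nonnegativity of \<open>g\<close> is asked on the half-line only, where the samples
  almost surely lie; odd powers are negative elsewhere.\<close>

lemma gamma_samples_strong_law:
  assumes g: "g \<in> borel_measurable borel" and nn: "\<And>x. 0 \<le> x \<Longrightarrow> 0 \<le> g x"
    and first: "has_bochner_integral lborel (\<lambda>x. gamma_density \<mu> l x * g x) m"
    and second: "has_bochner_integral lborel (\<lambda>x. gamma_density \<mu> l x * (g x)\<^sup>2) v"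
  shows "AE \<omega> in N. (\<lambda>n. (\<Sum>i<Suc n. g (\<alpha> (Suc i) \<omega>)) / real (Suc n)) \<longlonglongrightarrow> m"
proof -
  note d = distributed_has_bochner_integral[OF dist gamma_density_nonneg[OF pos]]
  have g2: "(\<lambda>x. (g x)\<^sup>2) \<in> borel_measurable borel" using g by measurable
  show ?thesis
  proof (rule prob_space.strong_law_indep_image[OF N ind g])
    fix k :: nat assume k: "1 \<le> k"
    show "integrable N (\<lambda>\<omega>. g (\<alpha> k \<omega>))" "(\<integral>\<omega>. g (\<alpha> k \<omega>) \<partial>N) = m"
      using d[OF k g first] by (auto simp: has_bochner_integral_iff)
    show "integrable N (\<lambda>\<omega>. (g (\<alpha> k \<omega>))\<^sup>2)" "(\<integral>\<omega>. (g (\<alpha> k \<omega>))\<^sup>2 \<partial>N) = v"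
      using d[OF k g2 second] by (auto simp: has_bochner_integral_iff)
    show "AE \<omega> in N. 0 \<le> g (\<alpha> k \<omega>)"
      using gamma_samples_nonneg
    proof eventually_elim
      case (elim \<omega>)
      then show ?case using elim[rule_format, of "k - 1"] k by (auto intro: nn)
    qed
  qed
qed

lemma gamma_samples_moments:
  "AE \<omega> in N. \<forall>j. (\<lambda>n. (\<Sum>i<Suc n. \<alpha> (Suc i) \<omega> ^ j) / real (Suc n)) \<longlonglongrightarrow> pochhammer \<mu> j / l ^ j"
proof (subst AE_all_countable, intro allI)
  fix j
  \<comment> \<open>The second moment of \<open>x ^ j\<close> is the moment of order 2j, so the same
    formula applies.\<close>
  have "has_bochner_integral lborel (\<lambda>x. gamma_density \<mu> l x * (x ^ j)\<^sup>2) (pochhammer \<mu> (j * 2) / l ^ (j * 2))"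
    using gamma_density_moment[OF pos, of "j * 2"] by (simp add: power_mult)
  from gamma_samples_strong_law[OF _ _ gamma_density_moment[OF pos] this]
  show "AE \<omega> in N. (\<lambda>n. (\<Sum>i<Suc n. \<alpha> (Suc i) \<omega> ^ j) / real (Suc n)) \<longlonglongrightarrow> pochhammer \<mu> j / l ^ j"
    by simp
qed

text \<open>The condition \<open>2 * e < l\<close> makes the second moment of
  \<open>exp (e * x)\<close>, an exponential moment at 2e, finite. The limit stays anonymous because
  later only convergence, hence boundedness, of these averages matters.\<close>

lemma gamma_samples_exp_moment:
  assumes "2 * e < l"
  shows "\<exists>E. AE \<omega> in N. (\<lambda>n. (\<Sum>i<Suc n. exp (e * \<alpha> (Suc i) \<omega>)) / real (Suc n)) \<longlonglongrightarrow> E"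
proof -
  have "has_bochner_integral lborel (\<lambda>x. gamma_density \<mu> l x * (exp (e * x))\<^sup>2) ((l / (l - 2 * e)) powr \<mu>)"
    using gamma_density_exp_moment[OF pos(1) assms pos(2)] by (simp add: exp_double[symmetric] mult.assoc)
  moreover have "e < l" using assms pos by linarith
  ultimately show ?thesis
    using gamma_samples_strong_law[of "\<lambda>x. exp (e * x)", OF _ _ gamma_density_exp_moment[OF pos(1) _ pos(2)]]
    by auto
qed

end

subsection \<open>Weighted series of empirical moments\<close>

text \<open>A Gautschi-type inequality. Log-convexity is applied at z + 1, the convex combination of
  z + d + 1 and z + d with weights 1 - d and d; the functional equation then removes the outer
  shifts.\<close>

lemma Gamma_add_ge:
  fixes z d :: real
  assumes "0 < z" "0 < d" "d \<le> 1"
  shows "z * (z + d) powr (d - 1) * Gamma z \<le> Gamma (z + d)"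
proof -
  have conv: "convex_on {0<..} (ln \<circ> Gamma :: real \<Rightarrow> real)" by (rule log_convex_Gamma_real)
  have "(ln \<circ> Gamma) ((1 - d) *\<^sub>R (z + d + 1) + d *\<^sub>R (z + d))
      \<le> (1 - d) * (ln \<circ> Gamma) (z + d + 1) + d * (ln \<circ> Gamma) (z + d)"
    using convex_onD[OF conv, of d "z + d + 1" "z + d"] assms by simp
  moreover have "(1 - d) *\<^sub>R (z + d + 1) + d *\<^sub>R (z + d) = z + 1"
    by (simp add: algebra_simps)
  ultimately have "ln (Gamma (z + 1)) \<le> (1 - d) * ln (Gamma (z + d + 1)) + d * ln (Gamma (z + d))"
    by simp
  moreover have "Gamma (z + d + 1) = (z + d) * Gamma (z + d)" "Gamma (z + 1) = z * Gamma z"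
    using assms by (auto simp: Gamma_plus1 nonpos_Ints_def)
  moreover have pos: "0 < Gamma (z + d)" "0 < Gamma z" using assms by (auto intro: Gamma_real_pos)
  moreover have "ln ((z + d) * Gamma (z + d)) = ln (z + d) + ln (Gamma (z + d))"
    using assms pos by (intro ln_mult_pos) auto
  ultimately have "ln (z * Gamma z) \<le> (1 - d) * (ln (z + d) + ln (Gamma (z + d))) + d * ln (Gamma (z + d))"
    by simp
  then have "ln (z * Gamma z) + (d - 1) * ln (z + d) \<le> ln (Gamma (z + d))"
    by (simp add: algebra_simps)
  moreover have "ln (z * Gamma z) + (d - 1) * ln (z + d) = ln (z * (z + d) powr (d - 1) * Gamma z)"
  proof -
    have "ln (z * (z + d) powr (d - 1) * Gamma z) = ln (z * (z + d) powr (d - 1)) + ln (Gamma z)"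
      using pos assms by (intro ln_mult_pos mult_pos_pos) auto
    moreover have "ln (z * (z + d) powr (d - 1)) = ln z + (d - 1) * ln (z + d)"
      using assms by (subst ln_mult_pos) (auto simp: ln_powr)
    moreover have "ln (z * Gamma z) = ln z + ln (Gamma z)"
      using pos assms by (intro ln_mult_pos) auto
    ultimately show ?thesis by simp
  qed
  moreover have "0 < z * (z + d) powr (d - 1) * Gamma z"
    using pos assms by (intro mult_pos_pos) auto
  ultimately show ?thesis
    using pos by (simp only: ln_le_cancel_iff)
qed

lemma ratio_tendsto_zero_imp_summable:
  fixes a :: "nat \<Rightarrow> real"
  assumes pos: "\<And>j. 0 < a j" and lim: "(\<lambda>j. a (Suc j) / a j) \<longlonglongrightarrow> 0"
  shows "summable a"
proof -
  have "\<forall>\<^sub>F j in sequentially. a (Suc j) / a j < 1 / 2"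
    using lim by (rule order_tendstoD) simp
  then obtain N where N: "\<And>j. j \<ge> N \<Longrightarrow> a (Suc j) / a j < 1 / 2"
    by (auto simp: eventually_sequentially)
  show ?thesis
  proof (rule summable_ratio_test[of "1 / 2" N])
    fix j assume "N \<le> j"
    from N[OF this] have "a (Suc j) < a j * (1 / 2)" using pos[of j] by (simp add: field_simps)
    then show "norm (a (Suc j)) \<le> 1 / 2 * norm (a j)"
      using pos[of j] pos[of "Suc j"] by simp
  qed simp
qed

text \<open>The ratio of consecutive terms is at most of order j powr (1 - \<rho>), which tends to 0
  exactly because \<rho> > 1.\<close>

lemma fact_over_Gamma_summable:
  fixes y \<rho> :: real
  assumes "0 < y" "1 < \<rho>" "\<rho> \<le> 2"
  shows "summable (\<lambda>j. y ^ j * fact j / Gamma (\<rho> * real j + 1))"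
proof (rule ratio_tendsto_zero_imp_summable)
  \<comment> \<open>One step of the progression raises the Gamma argument by 1 + d: the functional
    equation accounts for 1 and \<open>Gamma_add_ge\<close>, which needs 0 < d \<le> 1, for the
    rest.\<close>
  define d where "d = \<rho> - 1"
  have d: "0 < d" "d \<le> 1" using assms by (auto simp: d_def)
  have pos: "0 < Gamma (\<rho> * real j + 1)" for j
    using assms by (intro Gamma_real_pos) (auto intro!: add_nonneg_pos)
  show apos: "0 < y ^ j * fact j / Gamma (\<rho> * real j + 1)" for j
    using assms pos by simp
  have ratio: "(y ^ Suc j * fact (Suc j) / Gamma (\<rho> * real (Suc j) + 1)) / (y ^ j * fact j / Gamma (\<rho> * real j + 1))
      \<le> y / ((\<rho> * real j + 1) * (\<rho> * real j + \<rho>) powr (d - 1))" for j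
  proof -
    define z where "z = \<rho> * real j + 1"
    have z: "0 < z" using assms by (auto simp: z_def intro!: add_nonneg_pos)
    have zd: "z + d = \<rho> * (real j + 1)" by (simp add: z_def d_def algebra_simps)
    have "\<rho> * real (Suc j) + 1 = z + d + 1" unfolding zd by (simp add: algebra_simps)
    then have "Gamma (\<rho> * real (Suc j) + 1) = (z + d) * Gamma (z + d)"
      using Gamma_plus1[of "z + d"] z d by (simp add: nonpos_Ints_def)
    moreover have "z * (z + d) powr (d - 1) * Gamma z \<le> Gamma (z + d)"
      by (rule Gamma_add_ge) (use z d in auto)
    ultimately have "(z + d) * (z * (z + d) powr (d - 1) * Gamma z) \<le> Gamma (\<rho> * real (Suc j) + 1)"
      using z d by simp
    moreover have "0 < (z + d) * (z * (z + d) powr (d - 1) * Gamma z)"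
      using z d Gamma_real_pos[of z] by simp
    ultimately have "(y * (real j + 1)) * Gamma z / Gamma (\<rho> * real (Suc j) + 1)
       \<le> (y * (real j + 1)) * Gamma z / ((z + d) * (z * (z + d) powr (d - 1) * Gamma z))"
      using assms z d Gamma_real_pos[of z] pos[of "Suc j"] by (intro divide_left_mono mult_pos_pos) auto
    also have "\<dots> = y / (\<rho> * (z * (z + d) powr (d - 1)))"
    proof -
      define w where "w = (z + d) powr (d - 1)"
      have "0 < Gamma z" using z by (rule Gamma_real_pos)
      then have "w \<noteq> 0" "Gamma z \<noteq> 0" "real j + 1 \<noteq> 0"
        using z d by (auto simp: w_def less_imp_neq[symmetric])
      then have "y * (real j + 1) * Gamma z / (\<rho> * (real j + 1) * (z * w * Gamma z)) = y / (\<rho> * (z * w))"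
        using assms z by (simp add: divide_simps)
      then show ?thesis unfolding w_def zd .
    qed
    also have "\<dots> \<le> y / (z * (z + d) powr (d - 1))"
      using assms z d by (intro divide_left_mono mult_pos_pos) auto
    also have "(y * (real j + 1)) * Gamma z / Gamma (\<rho> * real (Suc j) + 1)
        = (y ^ Suc j * fact (Suc j) / Gamma (\<rho> * real (Suc j) + 1)) / (y ^ j * fact j / Gamma (\<rho> * real j + 1))"
      using assms by (simp add: z_def add.commute)
    finally show ?thesis
      unfolding zd unfolding z_def by (simp add: algebra_simps)
  qed
  have lim: "(\<lambda>j. y / ((\<rho> * real j + 1) * (\<rho> * real j + \<rho>) powr (d - 1))) \<longlonglongrightarrow> 0"
    using assms d by real_asymp
  show "(\<lambda>j. (y ^ Suc j * fact (Suc j) / Gamma (\<rho> * real (Suc j) + 1)) / (y ^ j * fact j / Gamma (\<rho> * real j + 1))) \<longlonglongrightarrow> 0"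
    by (rule tendsto_sandwich[OF _ _ tendsto_const lim])
       (intro always_eventually allI divide_nonneg_nonneg less_imp_le[OF apos] ratio)+
qed

text \<open>Weighted by e^j/j!, both the empirical and the limit moments have total mass bounded
  uniformly in n, by the averages of the exponentials. As \<open>c j\<close> is of smaller order
  than e^j/j!, the tails are uniformly small, and the finitely many remaining terms converge one by
  one.\<close>

lemma average_series_tendsto:
  fixes c m :: "nat \<Rightarrow> real" and x :: "nat \<Rightarrow> real"
  assumes x: "\<And>k. 0 \<le> x k" and e: "0 < e" and c: "\<And>j. 0 \<le> c j"
    and fc: "(\<lambda>j. c j * fact j / e ^ j) \<longlonglongrightarrow> 0"
    and mom: "\<And>j. (\<lambda>n. (\<Sum>k<Suc n. x k ^ j) / real (Suc n)) \<longlonglongrightarrow> m j"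
    and ex: "(\<lambda>n. (\<Sum>k<Suc n. exp (e * x k)) / real (Suc n)) \<longlonglongrightarrow> E"
  shows "summable (\<lambda>j. c j * \<bar>(\<Sum>k<Suc n. x k ^ j) / real (Suc n) - m j\<bar>)"
    and "summable (\<lambda>j. c j * \<bar>m j\<bar>)"
    and "(\<lambda>n. \<Sum>j. c j * \<bar>(\<Sum>k<Suc n. x k ^ j) / real (Suc n) - m j\<bar>) \<longlonglongrightarrow> 0"
proof -
  define a where "a n j = (\<Sum>k<Suc n. x k ^ j) / real (Suc n)" for n j
  define b where "b n = (\<Sum>k<Suc n. exp (e * x k)) / real (Suc n)" for n
  \<comment> \<open>For nonnegative arguments a finite part of the exponential series is below the
    exponential; this is averaged over the sample.\<close>
  have aJ: "(\<Sum>j\<in>J. e ^ j / fact j * a n j) \<le> b n" if "finite J" for J n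
  proof -
    have "(\<Sum>j\<in>J. e ^ j / fact j * a n j) = (\<Sum>k<Suc n. \<Sum>j\<in>J. (e * x k) ^ j / fact j) / real (Suc n)"
      unfolding a_def sum_divide_distrib sum_distrib_left
      by (subst sum.swap) (simp add: power_mult_distrib)
    also have "\<dots> \<le> (\<Sum>k<Suc n. exp (e * x k)) / real (Suc n)"
    proof (intro divide_right_mono sum_mono)
      fix k
      have "summable (\<lambda>j. (e * x k) ^ j / fact j)"
        using summable_exp[of "e * x k"] by (simp add: field_simps)
      moreover have "exp (e * x k) = (\<Sum>j. (e * x k) ^ j / fact j)"
        unfolding exp_def by (simp add: field_simps)
      ultimately show "(\<Sum>j\<in>J. (e * x k) ^ j / fact j) \<le> exp (e * x k)"
        using that x[of k] e by (simp add: sum_le_suminf)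
    qed simp
    finally show ?thesis unfolding b_def .
  qed
  have a_lim: "(\<lambda>n. a n j) \<longlonglongrightarrow> m j" for j using mom unfolding a_def .
  have b_lim: "b \<longlonglongrightarrow> E" using ex unfolding b_def .
  have a0: "0 \<le> a n j" for n j unfolding a_def using x by (intro divide_nonneg_nonneg sum_nonneg) auto
  have m0: "0 \<le> m j" for j using LIMSEQ_le_const[OF a_lim[of j], of 0] a0 by auto
  \<comment> \<open>Only finite sums pass to the limit, so no interchange of limit and series is
    needed.\<close>
  have mJ: "(\<Sum>j\<in>J. e ^ j / fact j * m j) \<le> E" if "finite J" for J
  proof (rule LIMSEQ_le[OF _ b_lim])
    show "(\<lambda>n. \<Sum>j\<in>J. e ^ j / fact j * a n j) \<longlonglongrightarrow> (\<Sum>j\<in>J. e ^ j / fact j * m j)"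
      by (intro tendsto_intros a_lim)
  qed (use aJ[OF that] in blast)
  have sa: "summable (\<lambda>j. e ^ j / fact j * a n j)" and sm: "summable (\<lambda>j. e ^ j / fact j * m j)" for n
    using aJ mJ a0 m0 e by (auto intro!: summableI_nonneg_bounded)
  \<comment> \<open>Boundedness of the quotient already yields summability; its convergence to 0 is
    kept for the tail estimate.\<close>
  have fc_bd: "\<exists>K\<ge>0. \<forall>j. c j \<le> K * (e ^ j / fact j)"
  proof -
    from convergent_imp_Bseq[OF convergentI[OF fc]]
    obtain K where "0 < K" "\<And>j. norm (c j * fact j / e ^ j) \<le> K"
      by (auto elim: BseqE)
    then have "\<forall>j. c j \<le> K * (e ^ j / fact j)"
      using e c by (simp add: field_simps)
    then show ?thesis using \<open>0 < K\<close> by (intro exI[of _ K]) auto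
  qed
  then obtain K where K: "0 \<le> K" "\<And>j. c j \<le> K * (e ^ j / fact j)" by blast
  have sca: "summable (\<lambda>j. c j * a n j)" and scm: "summable (\<lambda>j. c j * m j)" for n
  proof -
    show "summable (\<lambda>j. c j * a n j)"
      by (rule summable_comparison_test'[OF summable_mult[OF sa[of n], of K], of 0])
         (use mult_right_mono[OF K(2) a0] c a0 in \<open>auto simp: mult.assoc abs_mult\<close>)
    show "summable (\<lambda>j. c j * m j)"
      by (rule summable_comparison_test'[OF summable_mult[OF sm, of K], of 0])
         (use mult_right_mono[OF K(2) m0] c m0 in \<open>auto simp: mult.assoc abs_mult\<close>)
  qed
  have dist_le: "\<bar>a n j - m j\<bar> \<le> a n j + m j" for n j
    using a0[of n j] m0[of j] by (simp add: abs_le_iff)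
  have sd: "summable (\<lambda>j. c j * \<bar>a n j - m j\<bar>)" for n
    by (rule summable_comparison_test'[OF summable_add[OF sca[of n] scm], of 0])
       (use c dist_le in \<open>simp add: abs_mult distrib_left[symmetric] mult_left_mono\<close>)
  show "summable (\<lambda>j. c j * \<bar>(\<Sum>k<Suc n. x k ^ j) / real (Suc n) - m j\<bar>)"
    using sd unfolding a_def .
  show "summable (\<lambda>j. c j * \<bar>m j\<bar>)" using scm m0 by simp
  obtain B where B: "0 < B" "\<And>n. b n \<le> B" "E \<le> B"
  proof -
    from convergent_imp_Bseq[OF convergentI[OF b_lim]]
    obtain B where B: "0 < B" "\<And>n. norm (b n) \<le> B"
      by (auto elim: BseqE)
    then have "b n \<le> B" for n using abs_le_D1[of "b n" B] by simp
    then show ?thesis using that[of B] B(1) LIMSEQ_le_const2[OF b_lim, of B] by auto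
  qed
  have "(\<lambda>n. \<Sum>j. c j * \<bar>a n j - m j\<bar>) \<longlonglongrightarrow> 0"
  proof (rule LIMSEQ_I)
    fix r :: real assume r: "0 < r"
    \<comment> \<open>The tail is at most \<delta> times the two masses, each at most
      \<open>B\<close>, so it takes up r/2.\<close>
    define \<delta> where "\<delta> = r / (4 * B)"
    have \<delta>: "0 < \<delta>" using r B by (simp add: \<delta>_def)
    have "\<forall>\<^sub>F j in sequentially. c j * fact j / e ^ j < \<delta>"
      using fc \<delta> by (rule order_tendstoD)
    then obtain J where J: "\<And>j. j \<ge> J \<Longrightarrow> c j * fact j / e ^ j < \<delta>"
      by (auto simp: eventually_sequentially)
    have cJ: "c (j + J) \<le> \<delta> * (e ^ (j + J) / fact (j + J))" for j
      using J[of "j + J"] e by (simp add: field_simps)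
    have tail_bd: "(\<Sum>j. c (j + J) * \<bar>a n (j + J) - m (j + J)\<bar>) \<le> 2 * \<delta> * B" for n
    proof (rule suminf_le_const)
      show "summable (\<lambda>j. c (j + J) * \<bar>a n (j + J) - m (j + J)\<bar>)"
        using sd[of n] by (rule summable_ignore_initial_segment)
      fix k
      have "(\<Sum>j<k. c (j + J) * \<bar>a n (j + J) - m (j + J)\<bar>)
        \<le> (\<Sum>j<k. \<delta> * (e ^ (j + J) / fact (j + J)) * (a n (j + J) + m (j + J)))"
        using cJ a0 m0 c \<delta> e
        by (intro sum_mono mult_mono) (auto simp: dist_le)
      also have "\<dots> = \<delta> * ((\<Sum>j\<in>(\<lambda>j. j + J) ` {..<k}. e ^ j / fact j * a n j) + (\<Sum>j\<in>(\<lambda>j. j + J) ` {..<k}. e ^ j / fact j * m j))"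
        by (simp add: sum.reindex inj_on_def sum_distrib_left sum.distrib[symmetric] algebra_simps add_divide_distrib)
      also have "\<dots> \<le> \<delta> * (B + B)"
        using aJ[of "(\<lambda>j. j + J) ` {..<k}" n] mJ[of "(\<lambda>j. j + J) ` {..<k}"] B(2)[of n] B(3) \<delta>
        by (intro mult_left_mono add_mono) (auto intro: order.trans)
      finally show "(\<Sum>j<k. c (j + J) * \<bar>a n (j + J) - m (j + J)\<bar>) \<le> 2 * \<delta> * B" by simp
    qed
    have "(\<lambda>n. \<Sum>j<J. c j * \<bar>a n j - m j\<bar>) \<longlonglongrightarrow> (\<Sum>j<J. c j * \<bar>m j - m j\<bar>)"
      by (intro tendsto_intros a_lim)
    then have "\<forall>\<^sub>F n in sequentially. (\<Sum>j<J. c j * \<bar>a n j - m j\<bar>) < r / 2"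
      using r by (intro order_tendstoD) auto
    then obtain N where N: "\<And>n. n \<ge> N \<Longrightarrow> (\<Sum>j<J. c j * \<bar>a n j - m j\<bar>) < r / 2"
      by (auto simp: eventually_sequentially)
    show "\<exists>N. \<forall>n\<ge>N. norm ((\<Sum>j. c j * \<bar>a n j - m j\<bar>) - 0) < r"
    proof (intro exI allI impI)
      fix n assume "N \<le> n"
      have "(\<Sum>j. c j * \<bar>a n j - m j\<bar>) = (\<Sum>j. c (j + J) * \<bar>a n (j + J) - m (j + J)\<bar>) + (\<Sum>j<J. c j * \<bar>a n j - m j\<bar>)"
        by (rule suminf_split_initial_segment[OF sd])
      also have "\<dots> < 2 * \<delta> * B + r / 2"
        using tail_bd N[OF \<open>N \<le> n\<close>] by (intro add_le_less_mono) auto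
      also have "\<dots> = r" using B by (simp add: \<delta>_def field_simps)
      finally show "norm ((\<Sum>j. c j * \<bar>a n j - m j\<bar>) - 0) < r"
        using suminf_nonneg[OF sd[of n]] c by simp
    qed
  qed
  then show "(\<lambda>n. \<Sum>j. c j * \<bar>(\<Sum>k<Suc n. x k ^ j) / real (Suc n) - m j\<bar>) \<longlonglongrightarrow> 0"
    unfolding a_def .
qed

text \<open>For 0 \<le> v \<le> u each term changes by exactly |b_j| (u^j - v^j) in absolute value,
  whatever its sign. The series with absolute coefficients is thus a monotone function that controls
  the variation.\<close>

lemma power_series_oscillation:
  fixes b :: "nat \<Rightarrow> real"
  assumes s: "summable (\<lambda>j. \<bar>b j\<bar> * R ^ j)" and uv: "0 \<le> v" "v \<le> u" "u \<le> R"
  shows "\<bar>(\<Sum>j. b j * (- u) ^ j) - (\<Sum>j. b j * (- v) ^ j)\<bar> \<le> (\<Sum>j. \<bar>b j\<bar> * u ^ j) - (\<Sum>j. \<bar>b j\<bar> * v ^ j)"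
proof -
  have s1: "summable (\<lambda>j. \<bar>b j\<bar> * x ^ j)" if "0 \<le> x" "x \<le> R" for x
    by (rule summable_comparison_test'[OF s, of 0])
       (use that in \<open>auto simp: abs_mult power_abs intro!: mult_left_mono power_mono\<close>)
  have s2: "summable (\<lambda>j. b j * (- x) ^ j)" if "0 \<le> x" "x \<le> R" for x
    by (rule summable_rabs_cancel) (use s1[OF that] that in \<open>simp add: abs_mult power_abs\<close>)
  have R: "0 \<le> u" "v \<le> R" using uv by auto
  note S = s1[OF R(1) uv(3)] s1[OF uv(1) R(2)] s2[OF R(1) uv(3)] s2[OF uv(1) R(2)]
  have le: "\<bar>b j * (- u) ^ j - b j * (- v) ^ j\<bar> \<le> \<bar>b j\<bar> * u ^ j - \<bar>b j\<bar> * v ^ j" for j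
  proof -
    have "b j * (- u) ^ j - b j * (- v) ^ j = b j * (- 1) ^ j * (u ^ j - v ^ j)"
      by (simp add: power_minus[of u] power_minus[of v] algebra_simps)
    moreover have "0 \<le> u ^ j - v ^ j" using uv by (simp add: power_mono)
    ultimately have "\<bar>b j * (- u) ^ j - b j * (- v) ^ j\<bar> = \<bar>b j\<bar> * (u ^ j - v ^ j)"
      by (simp only: abs_mult power_abs) simp
    then show ?thesis by (simp add: right_diff_distrib)
  qed
  have sd: "summable (\<lambda>j. \<bar>b j\<bar> * u ^ j - \<bar>b j\<bar> * v ^ j)" using S by (intro summable_diff)
  have sa: "summable (\<lambda>j. \<bar>b j * (- u) ^ j - b j * (- v) ^ j\<bar>)"
    by (rule summable_comparison_test'[OF sd, of 0]) (use le in auto)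
  have "\<bar>(\<Sum>j. b j * (- u) ^ j) - (\<Sum>j. b j * (- v) ^ j)\<bar> = \<bar>\<Sum>j. b j * (- u) ^ j - b j * (- v) ^ j\<bar>"
    using S by (simp add: suminf_diff)
  also have "\<dots> \<le> (\<Sum>j. \<bar>b j * (- u) ^ j - b j * (- v) ^ j\<bar>)" by (rule summable_rabs[OF sa])
  also have "\<dots> \<le> (\<Sum>j. \<bar>b j\<bar> * u ^ j - \<bar>b j\<bar> * v ^ j)" by (rule suminf_le[OF le sa sd])
  also have "\<dots> = (\<Sum>j. \<bar>b j\<bar> * u ^ j) - (\<Sum>j. \<bar>b j\<bar> * v ^ j)"
    using S by (simp add: suminf_diff)
  finally show ?thesis .
qed

subsection \<open>Series expansion of the scalar resolvent\<close>

text \<open>The powers are taken of \<open>t powr \<rho>\<close>, since \<open>0 powr 0 = 0\<close>.\<close>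

definition mittag_leffler_partial :: "real \<Rightarrow> real \<Rightarrow> nat \<Rightarrow> real \<Rightarrow> real" where
  "mittag_leffler_partial \<rho> a n t = (\<Sum>k<n. (- a * t powr \<rho>) ^ k / Gamma (\<rho> * real k + 1))"

lemma set_integral_sum_real:
  fixes f :: "'i \<Rightarrow> 'a \<Rightarrow> real"
  assumes "\<And>i. i \<in> I \<Longrightarrow> set_integrable M A (f i)"
  shows "set_integrable M A (\<lambda>x. \<Sum>i\<in>I. f i x)"
    and "(LINT x:A|M. (\<Sum>i\<in>I. f i x)) = (\<Sum>i\<in>I. LINT x:A|M. f i x)"
  using assms unfolding set_integrable_def set_lebesgue_integral_def
  by (simp_all add: scaleR_sum_right sum_distrib_left Bochner_Integration.integral_sum)

text \<open>Convolution with the kernel sends each power occurring in the Mittag-Leffler series to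
  the next one. After rescaling to the unit interval the integral is a Beta integral.\<close>

lemma frac_kernel_convolution_power:
  fixes \<rho> t :: real
  assumes \<rho>: "1 < \<rho>" and t: "0 \<le> t"
  shows "set_integrable lborel {0..t} (\<lambda>\<tau>. frac_kernel \<rho> (t - \<tau>) * (\<tau> powr \<rho>) ^ k)"
    and "(LBINT \<tau>:{0..t}. frac_kernel \<rho> (t - \<tau>) * ((\<tau> powr \<rho>) ^ k / Gamma (\<rho> * real k + 1)))
      = (t powr \<rho>) ^ Suc k / Gamma (\<rho> * real (Suc k) + 1)"
proof -
  have G\<rho>: "Gamma \<rho> \<noteq> 0" using Gamma_real_pos[of \<rho>] \<rho> by linarith
  have cont: "continuous_on {0..t} (\<lambda>\<tau>. frac_kernel \<rho> (t - \<tau>) * (\<tau> powr \<rho>) ^ k)"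
    unfolding frac_kernel_def using \<rho> t G\<rho>
    by (auto intro!: continuous_intros continuous_on_powr')
  show int: "set_integrable lborel {0..t} (\<lambda>\<tau>. frac_kernel \<rho> (t - \<tau>) * (\<tau> powr \<rho>) ^ k)"
    by (rule borel_integrable_atLeastAtMost'[OF cont])
  have pw: "(x powr \<rho>) ^ k = x powr (\<rho> * real k)" if "0 < x" for x
    using that by (simp add: powr_powr powr_realpow[symmetric])
  have pos: "0 < Gamma (\<rho> * real k + 1)" using \<rho> by (intro Gamma_real_pos add_nonneg_pos) auto
  have "((\<lambda>\<tau>. frac_kernel \<rho> (t - \<tau>) * (\<tau> powr \<rho>) ^ k) has_integral
      Gamma (\<rho> * real k + 1) * (t powr \<rho>) ^ Suc k / Gamma (\<rho> * real (Suc k) + 1)) {0..t}"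
  proof (cases "t = 0")
    case False
    then have t: "0 < t" using t by simp
    let ?f = "\<lambda>x. x powr ((\<rho> * real k + 1) - 1) * (1 - x) powr (\<rho> - 1)"
    have "(?f has_integral Beta (\<rho> * real k + 1) \<rho>) {0..1}"
      using \<rho> by (intro has_integral_Beta_real add_nonneg_pos) auto
    then have "(?f has_integral Beta (\<rho> * real k + 1) \<rho>) (cbox 0 1)" by simp
    from has_integral_affinity[OF this, of "1 / t" 0]
    have "((\<lambda>x. ?f (x / t)) has_integral t * Beta (\<rho> * real k + 1) \<rho>) {0..t}"
      using t by simp
    from has_integral_mult_right[OF this, of "t powr (\<rho> * real k + \<rho> - 1) / Gamma \<rho>"]
    have "((\<lambda>x. t powr (\<rho> * real k + \<rho> - 1) / Gamma \<rho> * ?f (x / t)) has_integral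
       t powr (\<rho> * real k + \<rho> - 1) / Gamma \<rho> * (t * Beta (\<rho> * real k + 1) \<rho>)) {0..t}" .
    moreover have "t powr (\<rho> * real k + \<rho> - 1) / Gamma \<rho> * (t * Beta (\<rho> * real k + 1) \<rho>)
        = Gamma (\<rho> * real k + 1) * (t powr \<rho>) ^ Suc k / Gamma (\<rho> * real (Suc k) + 1)"
    proof -
      have "t powr (\<rho> * real k + \<rho> - 1) * t = t powr (\<rho> * real k + \<rho>)"
        using t by (simp add: powr_diff)
      also have "\<dots> = (t powr \<rho>) ^ Suc k"
        using t by (simp add: powr_powr powr_realpow[symmetric] powr_add algebra_simps del: power_Suc)
      finally show ?thesis using G\<rho> unfolding Beta_def by (simp add: algebra_simps)
    qed
    ultimately have "((\<lambda>x. t powr (\<rho> * real k + \<rho> - 1) / Gamma \<rho> * ?f (x / t)) has_integral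
        Gamma (\<rho> * real k + 1) * (t powr \<rho>) ^ Suc k / Gamma (\<rho> * real (Suc k) + 1)) {0..t}"
      by simp
    then show ?thesis
    \<comment> \<open>The point 0 is excluded: for \<open>k = 0\<close> the power
      \<open>(0 powr \<rho>) ^ 0\<close> is 1 while \<open>0 powr 0\<close> is 0.\<close>
    proof (rule has_integral_spike[of "{0}", rotated 2])
      fix x assume x: "x \<in> {0..t} - {0}"
      then have x0: "0 < x" "x \<le> t" by auto
      have "1 - x / t = (t - x) / t" using t by (simp add: field_simps)
      then have "?f (x / t) = x powr (\<rho> * real k) / t powr (\<rho> * real k) * ((t - x) powr (\<rho> - 1) / t powr (\<rho> - 1))"
        using t x0 by (simp add: powr_divide)
      moreover have "t powr (\<rho> * real k + \<rho> - 1) = t powr (\<rho> * real k) * t powr (\<rho> - 1)"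
        by (simp add: powr_add[symmetric] algebra_simps)
      ultimately show "frac_kernel \<rho> (t - x) * (x powr \<rho>) ^ k = t powr (\<rho> * real k + \<rho> - 1) / Gamma \<rho> * ?f (x / t)"
        unfolding frac_kernel_def pw[OF x0(1)] using t by (simp add: field_simps)
    qed simp
  qed (use \<rho> in \<open>simp add: has_integral_refl\<close>)
  then have "(LBINT \<tau>:{0..t}. frac_kernel \<rho> (t - \<tau>) * (\<tau> powr \<rho>) ^ k)
      = Gamma (\<rho> * real k + 1) * (t powr \<rho>) ^ Suc k / Gamma (\<rho> * real (Suc k) + 1)"
    using set_borel_integral_eq_integral(2)[OF int] by (simp add: integral_unique)
  moreover have "(LBINT \<tau>:{0..t}. frac_kernel \<rho> (t - \<tau>) * ((\<tau> powr \<rho>) ^ k / Gamma (\<rho> * real k + 1)))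
    = (LBINT \<tau>:{0..t}. frac_kernel \<rho> (t - \<tau>) * (\<tau> powr \<rho>) ^ k) / Gamma (\<rho> * real k + 1)"
    by (simp add: times_divide_eq_right)
  ultimately show "(LBINT \<tau>:{0..t}. frac_kernel \<rho> (t - \<tau>) * ((\<tau> powr \<rho>) ^ k / Gamma (\<rho> * real k + 1)))
      = (t powr \<rho>) ^ Suc k / Gamma (\<rho> * real (Suc k) + 1)"
    using pos by simp
qed

text \<open>The partial sums are the Picard iterates of the Volterra equation, started at the empty
  sum 0.\<close>

lemma mittag_leffler_partial_Suc:
  assumes \<rho>: "1 < \<rho>" and t: "0 \<le> t"
  shows "set_integrable lborel {0..t} (\<lambda>\<tau>. frac_kernel \<rho> (t - \<tau>) * mittag_leffler_partial \<rho> a n \<tau>)"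
    and "mittag_leffler_partial \<rho> a (Suc n) t
      = 1 - a * (LBINT \<tau>:{0..t}. frac_kernel \<rho> (t - \<tau>) * mittag_leffler_partial \<rho> a n \<tau>)"
proof -
  have eq: "frac_kernel \<rho> (t - \<tau>) * mittag_leffler_partial \<rho> a n \<tau>
      = (\<Sum>k<n. (- a) ^ k * (frac_kernel \<rho> (t - \<tau>) * ((\<tau> powr \<rho>) ^ k / Gamma (\<rho> * real k + 1))))" for \<tau>
    unfolding mittag_leffler_partial_def sum_distrib_left power_mult_distrib
    by (intro sum.cong refl) (simp add: mult_ac)
  have i: "set_integrable lborel {0..t} (\<lambda>\<tau>. (- a) ^ k * (frac_kernel \<rho> (t - \<tau>) * ((\<tau> powr \<rho>) ^ k / Gamma (\<rho> * real k + 1))))" for k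
    using frac_kernel_convolution_power(1)[OF \<rho> t, of k]
    by (intro set_integrable_mult_right) (simp add: times_divide_eq_right)
  show "set_integrable lborel {0..t} (\<lambda>\<tau>. frac_kernel \<rho> (t - \<tau>) * mittag_leffler_partial \<rho> a n \<tau>)"
    unfolding eq by (intro set_integral_sum_real i)
  have "(LBINT \<tau>:{0..t}. frac_kernel \<rho> (t - \<tau>) * mittag_leffler_partial \<rho> a n \<tau>)
      = (\<Sum>k<n. (- a) ^ k * ((t powr \<rho>) ^ Suc k / Gamma (\<rho> * real (Suc k) + 1)))"
    unfolding eq by (subst set_integral_sum_real(2)[OF i])
      (simp only: set_integral_mult_right frac_kernel_convolution_power(2)[OF \<rho> t])
  then have "1 - a * (LBINT \<tau>:{0..t}. frac_kernel \<rho> (t - \<tau>) * mittag_leffler_partial \<rho> a n \<tau>)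
      = 1 + (\<Sum>k<n. (- a * t powr \<rho>) ^ Suc k / Gamma (\<rho> * real (Suc k) + 1))"
    unfolding power_mult_distrib
    by (simp add: sum_distrib_left sum_negf[symmetric] mult_ac del: of_nat_Suc)
  also have "\<dots> = mittag_leffler_partial \<rho> a (Suc n) t"
    unfolding mittag_leffler_partial_def by (subst sum.lessThan_Suc_shift) simp
  finally show "mittag_leffler_partial \<rho> a (Suc n) t
      = 1 - a * (LBINT \<tau>:{0..t}. frac_kernel \<rho> (t - \<tau>) * mittag_leffler_partial \<rho> a n \<tau>)" ..
qed

text \<open>Iterating the Volterra equation leaves a remainder that is itself dominated by a term of the
  Mittag-Leffler series; this gives existence of the expansion and uniqueness at once.\<close>

lemma scalar_resolvent_remainder:
  assumes \<rho>: "1 < \<rho>" and a: "0 \<le> a" and s: "scalar_resolvent \<rho> a s"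
    and B: "\<And>t. 0 \<le> t \<Longrightarrow> t \<le> T \<Longrightarrow> \<bar>s t\<bar> \<le> B"
  shows "0 \<le> t \<Longrightarrow> t \<le> T \<Longrightarrow>
    \<bar>s t - mittag_leffler_partial \<rho> a n t\<bar> \<le> B * ((a * t powr \<rho>) ^ n / Gamma (\<rho> * real n + 1))"
proof (induction n arbitrary: t)
  case 0
  then show ?case using B by (simp add: mittag_leffler_partial_def)
next
  case (Suc n)
  have "0 < Gamma \<rho>" using \<rho> by (intro Gamma_real_pos) auto
  then have G\<rho>: "Gamma \<rho> \<noteq> 0" and ker: "0 \<le> frac_kernel \<rho> x" for x
    unfolding frac_kernel_def by (linarith, simp)
  have cont: "continuous_on {0..t} (\<lambda>\<tau>. frac_kernel \<rho> (t - \<tau>) * s \<tau>)"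
    using s \<rho> G\<rho> unfolding scalar_resolvent_def frac_kernel_def
    by (auto intro!: continuous_intros continuous_on_powr' intro: continuous_on_subset)
  have i1: "set_integrable lborel {0..t} (\<lambda>\<tau>. frac_kernel \<rho> (t - \<tau>) * s \<tau>)"
    by (rule borel_integrable_atLeastAtMost'[OF cont])
  note i2 = mittag_leffler_partial_Suc(1)[OF \<rho> Suc.prems(1), of a n]
  have i3: "set_integrable lborel {0..t} (\<lambda>\<tau>. frac_kernel \<rho> (t - \<tau>) * (s \<tau> - mittag_leffler_partial \<rho> a n \<tau>))"
    using set_integral_diff(1)[OF i1 i2] by (simp add: right_diff_distrib)
  have i4: "set_integrable lborel {0..t} (\<lambda>\<tau>. (B * a ^ n) * (frac_kernel \<rho> (t - \<tau>) * ((\<tau> powr \<rho>) ^ n / Gamma (\<rho> * real n + 1))))"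
    using frac_kernel_convolution_power(1)[OF \<rho> Suc.prems(1), of n]
    by (intro set_integrable_mult_right) (simp add: times_divide_eq_right)
  have "s t = 1 - a * (LBINT \<tau>:{0..t}. frac_kernel \<rho> (t - \<tau>) * s \<tau>)"
    using s Suc.prems unfolding scalar_resolvent_def by (simp only: eq_diff_eq)
  \<comment> \<open>The Volterra equation and the Picard step have the same form, so the new error
    is the convolution of the old one.\<close>
  then have "s t - mittag_leffler_partial \<rho> a (Suc n) t
      = - a * (LBINT \<tau>:{0..t}. frac_kernel \<rho> (t - \<tau>) * (s \<tau> - mittag_leffler_partial \<rho> a n \<tau>))"
    using set_integral_diff(2)[OF i1 i2]
    unfolding mittag_leffler_partial_Suc(2)[OF \<rho> Suc.prems(1)]
    by (simp add: right_diff_distrib)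
  then have "\<bar>s t - mittag_leffler_partial \<rho> a (Suc n) t\<bar>
      = a * \<bar>LBINT \<tau>:{0..t}. frac_kernel \<rho> (t - \<tau>) * (s \<tau> - mittag_leffler_partial \<rho> a n \<tau>)\<bar>"
    using a by (simp add: abs_mult)
  also have "\<dots> \<le> a * (LBINT \<tau>:{0..t}. (B * a ^ n) * (frac_kernel \<rho> (t - \<tau>) * ((\<tau> powr \<rho>) ^ n / Gamma (\<rho> * real n + 1))))"
  proof (intro mult_left_mono a)
    have "\<bar>LBINT \<tau>:{0..t}. frac_kernel \<rho> (t - \<tau>) * (s \<tau> - mittag_leffler_partial \<rho> a n \<tau>)\<bar>
      \<le> (LBINT \<tau>:{0..t}. \<bar>frac_kernel \<rho> (t - \<tau>) * (s \<tau> - mittag_leffler_partial \<rho> a n \<tau>)\<bar>)"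
      using integral_abs_bound[of lborel "\<lambda>\<tau>. indicator {0..t} \<tau> *\<^sub>R (frac_kernel \<rho> (t - \<tau>) * (s \<tau> - mittag_leffler_partial \<rho> a n \<tau>))"]
      unfolding set_lebesgue_integral_def by (simp add: abs_mult)
    also have "\<dots> \<le> (LBINT \<tau>:{0..t}. (B * a ^ n) * (frac_kernel \<rho> (t - \<tau>) * ((\<tau> powr \<rho>) ^ n / Gamma (\<rho> * real n + 1))))"
    proof (rule set_integral_mono[OF set_integrable_abs[OF i3] i4])
      fix \<tau> assume \<tau>: "\<tau> \<in> {0..t}"
      have "\<bar>s \<tau> - mittag_leffler_partial \<rho> a n \<tau>\<bar> \<le> B * ((a * \<tau> powr \<rho>) ^ n / Gamma (\<rho> * real n + 1))"
        using Suc.IH[of \<tau>] \<tau> Suc.prems by auto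
      from mult_left_mono[OF this ker[of "t - \<tau>"]]
      show "\<bar>frac_kernel \<rho> (t - \<tau>) * (s \<tau> - mittag_leffler_partial \<rho> a n \<tau>)\<bar>
        \<le> (B * a ^ n) * (frac_kernel \<rho> (t - \<tau>) * ((\<tau> powr \<rho>) ^ n / Gamma (\<rho> * real n + 1)))"
        using ker[of "t - \<tau>"] by (simp add: abs_mult power_mult_distrib mult_ac)
    qed
    finally show "\<bar>LBINT \<tau>:{0..t}. frac_kernel \<rho> (t - \<tau>) * (s \<tau> - mittag_leffler_partial \<rho> a n \<tau>)\<bar> \<le> \<dots>" .
  qed
  \<comment> \<open>The induction bound is shaped like a term of the series, so convolving it gives
    the next term exactly.\<close>
  also have "\<dots> = B * ((a * t powr \<rho>) ^ Suc n / Gamma (\<rho> * real (Suc n) + 1))"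
    unfolding set_integral_mult_right frac_kernel_convolution_power(2)[OF \<rho> Suc.prems(1)]
    by (simp add: power_mult_distrib mult_ac del: of_nat_Suc)
  finally show ?case .
qed

lemma scalar_resolvent_sums:
  assumes \<rho>: "1 < \<rho>" and a: "0 \<le> a" and s: "scalar_resolvent \<rho> a s" and t: "0 \<le> t"
    and summ: "\<And>y. 0 < y \<Longrightarrow> summable (\<lambda>k. y ^ k / Gamma (\<rho> * real k + 1))"
  shows "(\<lambda>k. (- a * t powr \<rho>) ^ k / Gamma (\<rho> * real k + 1)) sums s t"
proof -
  have "continuous_on {0..t} s"
    using s unfolding scalar_resolvent_def by (auto intro: continuous_on_subset)
  then have "compact (s ` {0..t})" by (intro compact_continuous_image) auto
  then have "bounded (s ` {0..t})" by (rule compact_imp_bounded)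
  then obtain B where "\<forall>x\<in>s ` {0..t}. norm x \<le> B" unfolding bounded_iff ..
  then have B: "\<bar>s u\<bar> \<le> B" if "0 \<le> u" "u \<le> t" for u using that by auto
  \<comment> \<open>Summability is assumed for positive arguments, while
    \<open>a * t powr \<rho>\<close> may be 0; adding 1 keeps a majorant that is positive.\<close>
  define y where "y = a * t powr \<rho> + 1"
  have y: "0 < y" "0 \<le> a * t powr \<rho>" "a * t powr \<rho> \<le> y" using a by (auto simp: y_def add_nonneg_pos)
  have B0: "0 \<le> B" using B[of t] t abs_ge_zero[of "s t"] by linarith
  have pos: "0 < Gamma (\<rho> * real k + 1)" for k using \<rho> by (intro Gamma_real_pos add_nonneg_pos) auto
  have lim: "(\<lambda>n. B * (y ^ n / Gamma (\<rho> * real n + 1))) \<longlonglongrightarrow> 0"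
    using tendsto_mult_right_zero[OF summable_LIMSEQ_zero[OF summ[OF y(1)]]] .
  have "(\<lambda>n. s t - mittag_leffler_partial \<rho> a n t) \<longlonglongrightarrow> 0"
  proof (rule Lim_null_comparison[OF _ lim], intro always_eventually allI)
    fix n
    have "norm (s t - mittag_leffler_partial \<rho> a n t) \<le> B * ((a * t powr \<rho>) ^ n / Gamma (\<rho> * real n + 1))"
      using scalar_resolvent_remainder[OF \<rho> a s, of t B t n] B t by auto
    also have "\<dots> \<le> B * (y ^ n / Gamma (\<rho> * real n + 1))"
      using B0 y pos[of n] by (intro mult_left_mono divide_right_mono power_mono) auto
    finally show "norm (s t - mittag_leffler_partial \<rho> a n t) \<le> B * (y ^ n / Gamma (\<rho> * real n + 1))" .
  qed
  from tendsto_diff[OF tendsto_const[of "s t"] this] show ?thesis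
    unfolding sums_def mittag_leffler_partial_def by simp
qed

subsection \<open>Laws of continuous processes\<close>

text \<open>The members of \<open>cfunspace\<close> are bounded continuous functions; compactness of
  \<open>{0..T}\<close> makes boundedness automatic.\<close>

lemma mspace_path_space:
  "mspace (cfunspace (top_of_set {0..T}) euclidean_metric)
    = {f. f \<in> extensional {0..T} \<and> continuous_on {0..T} (f :: real \<Rightarrow> real)}"
  by (subst compactin_mspace_cfunspace) (auto simp: compactin_subtopology)

lemma topspace_path_space: "topspace (path_space T) = {f. f \<in> extensional {0..T} \<and> continuous_on {0..T} f}"
  unfolding path_space_def topspace_mtopology_of mspace_path_space ..

lemma restrict_in_path_space:
  "continuous_on {0..T} f \<Longrightarrow> restrict f {0..T} \<in> topspace (path_space T)"
  unfolding topspace_path_space by (auto intro: continuous_on_eq)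

lemma path_space_dist_le_iff:
  assumes "0 \<le> T" "f \<in> topspace (path_space T)" "g \<in> topspace (path_space T)"
  shows "mdist (cfunspace (top_of_set {0..T}) euclidean_metric) f g \<le> r \<longleftrightarrow> (\<forall>t\<in>{0..T}. \<bar>f t - g t\<bar> \<le> r)"
  using assms cfunspace_mdist_le[of f "top_of_set {0..T}" euclidean_metric g r]
  unfolding path_space_def topspace_mtopology_of by (auto simp: dist_real_def)

text \<open>Closed balls are used because a bound \<open>\<le> r\<close> on the supremum distance is
  the same as a pointwise bound.\<close>

lemma openin_path_space_iff:
  assumes "0 \<le> T"
  shows "openin (path_space T) U \<longleftrightarrow> U \<subseteq> topspace (path_space T) \<and>
    (\<forall>f\<in>U. \<exists>r>0. \<forall>g\<in>topspace (path_space T). (\<forall>t\<in>{0..T}. \<bar>f t - g t\<bar> \<le> r) \<longrightarrow> g \<in> U)"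
    (is "_ \<longleftrightarrow> ?R")
proof -
  let ?m = "cfunspace (top_of_set {0..T}) euclidean_metric :: (real \<Rightarrow> real) metric"
  have top: "topspace (path_space T) = mspace ?m" unfolding path_space_def by simp
  have "openin (path_space T) U \<longleftrightarrow> U \<subseteq> mspace ?m \<and>
      (\<forall>f\<in>U. \<exists>r>0. Metric_space.mball (mspace ?m) (mdist ?m) f r \<subseteq> U)"
    unfolding path_space_def mtopology_of_def
    by (subst Metric_space.openin_mtopology[OF Metric_space_mspace_mdist]) blast
  also have "\<dots> \<longleftrightarrow> ?R"
    unfolding top
  proof (intro conj_cong refl ball_cong)
    fix f assume U: "U \<subseteq> mspace ?m" and f: "f \<in> U"
    then have fm: "f \<in> mspace ?m" by blast
    have ball: "g \<in> Metric_space.mball (mspace ?m) (mdist ?m) f r \<longleftrightarrow> g \<in> mspace ?m \<and> mdist ?m f g < r" for g r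
      using fm Metric_space.in_mball[OF Metric_space_mspace_mdist, of g ?m f r] by blast
    note le = path_space_dist_le_iff[OF assms, unfolded top]
    show "(\<exists>r>0. Metric_space.mball (mspace ?m) (mdist ?m) f r \<subseteq> U) \<longleftrightarrow>
      (\<exists>r>0. \<forall>g\<in>mspace ?m. (\<forall>t\<in>{0..T}. \<bar>f t - g t\<bar> \<le> r) \<longrightarrow> g \<in> U)"
    proof safe
      fix r :: real assume r: "0 < r" "Metric_space.mball (mspace ?m) (mdist ?m) f r \<subseteq> U"
      \<comment> \<open>Halving the radius places the closed ball inside the open one.\<close>
      have "g \<in> U" if "g \<in> mspace ?m" "\<forall>t\<in>{0..T}. \<bar>f t - g t\<bar> \<le> r / 2" for g
        using that le[OF fm that(1), of "r / 2"] r ball[of g r] by auto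
      then show "\<exists>r>0. \<forall>g\<in>mspace ?m. (\<forall>t\<in>{0..T}. \<bar>f t - g t\<bar> \<le> r) \<longrightarrow> g \<in> U"
        using r(1) by (intro exI[of _ "r / 2"]) auto
    next
      fix r :: real assume r: "0 < r" "\<forall>g\<in>mspace ?m. (\<forall>t\<in>{0..T}. \<bar>f t - g t\<bar> \<le> r) \<longrightarrow> g \<in> U"
      have "g \<in> U" if "g \<in> Metric_space.mball (mspace ?m) (mdist ?m) f r" for g
        using that le[OF fm, of g r] r ball[of g r] by auto
      then show "\<exists>r>0. Metric_space.mball (mspace ?m) (mdist ?m) f r \<subseteq> U"
        using r(1) by blast
    qed
  qed
  finally show ?thesis .
qed

section \<open>Separability of the path space and measurability of the path map\<close>

text \<open>Bernstein polynomials with rational coefficients, rescaled to \<open>{0..T}\<close>, of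
  degree one less than the length of the list. Coding them by lists of rationals makes the family
  countable by its type.\<close>

definition bernstein_path :: "real \<Rightarrow> rat list \<Rightarrow> real \<Rightarrow> real" where
  "bernstein_path T qs t = (\<Sum>k\<le>length qs - 1. of_rat (qs ! k) * Bernstein (length qs - 1) k (t / T))"

text \<open>Half of \<open>e\<close> pays for the Bernstein approximation, half for rounding its
  coefficients; the Bernstein basis is a partition of unity on the unit interval, so the rounding
  error does not accumulate.\<close>

lemma bernstein_path_dense:
  assumes T: "0 < T" and f: "continuous_on {0..T} f" and e: "0 < e"
  shows "\<exists>qs. \<forall>t\<in>{0..T}. \<bar>f t - bernstein_path T qs t\<bar> \<le> e"
proof -
  have "continuous_on {0..1} (\<lambda>x. f (x * T))"
    by (rule continuous_on_compose2[OF f]) (use T in \<open>auto intro!: continuous_intros simp: mult_left_le_one_le\<close>)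
  from Bernstein_Weierstrass[OF this, of "e / 2"] e
  obtain n where n: "\<And>x. x \<in> {0..1} \<Longrightarrow> \<bar>f (x * T) - (\<Sum>k\<le>n. f (real k / real n * T) * Bernstein n k x)\<bar> < e / 2"
    by auto
  have "\<exists>q. \<bar>f (real k / real n * T) - of_rat q\<bar> \<le> e / 2" for k
  proof -
    obtain q where "f (real k / real n * T) - e / 2 < of_rat q" "of_rat q < f (real k / real n * T) + e / 2"
      using of_rat_dense[of "f (real k / real n * T) - e / 2" "f (real k / real n * T) + e / 2"] e by auto
    then show ?thesis by (intro exI[of _ q]) linarith
  qed
  then obtain q where q: "\<And>k. \<bar>f (real k / real n * T) - of_rat (q k)\<bar> \<le> e / 2" by metis
  define qs where "qs = map q [0..<Suc n]"
  have len: "length qs - 1 = n" and nth: "k \<le> n \<Longrightarrow> qs ! k = q k" for k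
    unfolding qs_def by (simp, subst nth_map, auto simp del: upt_Suc)
  have "\<bar>f t - bernstein_path T qs t\<bar> \<le> e" if t: "t \<in> {0..T}" for t
  proof -
    have x: "t / T \<in> {0..1}" using t T by auto
    have "bernstein_path T qs t = (\<Sum>k\<le>n. of_rat (q k) * Bernstein n k (t / T))"
      unfolding bernstein_path_def len by (intro sum.cong refl) (simp add: nth)
    then have "\<bar>(\<Sum>k\<le>n. f (real k / real n * T) * Bernstein n k (t / T)) - bernstein_path T qs t\<bar>
      = \<bar>\<Sum>k\<le>n. (f (real k / real n * T) - of_rat (q k)) * Bernstein n k (t / T)\<bar>"
      by (simp add: sum_subtractf[symmetric] algebra_simps)
    also have "\<dots> \<le> (\<Sum>k\<le>n. e / 2 * Bernstein n k (t / T))"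
    proof (intro order.trans[OF sum_abs] sum_mono)
      fix k
      have B: "0 \<le> Bernstein n k (t / T)" using x by (intro Bernstein_nonneg) auto
      show "\<bar>(f (real k / real n * T) - of_rat (q k)) * Bernstein n k (t / T)\<bar> \<le> e / 2 * Bernstein n k (t / T)"
        using mult_right_mono[OF q[of k] B] B by (simp only: abs_mult abs_of_nonneg)
    qed
    also have "\<dots> = e / 2" by (simp add: sum_distrib_left[symmetric] del: times_divide_eq_left)
    finally have "\<bar>(\<Sum>k\<le>n. f (real k / real n * T) * Bernstein n k (t / T)) - bernstein_path T qs t\<bar> \<le> e / 2" .
    moreover have "t / T * T = t" using T by simp
    ultimately show ?thesis using n[OF x] by (simp only:)
  qed
  then show ?thesis by blast
qed

lemma continuous_on_le_if_le_on_rationals: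
  fixes f :: "real \<Rightarrow> real"
  assumes T: "0 < T" and f: "continuous_on {0..T} f"
    and le: "\<And>t. t \<in> {0..T} \<inter> \<rat> \<Longrightarrow> f t \<le> c" and t: "t \<in> {0..T}"
  shows "f t \<le> c"
proof -
  have "closure ({0<..<T} \<inter> \<rat>) = closure {0<..<T}"
    by (rule closure_open_Int_superset) (auto simp: Rats_closure_real)
  also have "\<dots> = {0..T}" using T by simp
  finally have cl: "closure ({0<..<T} \<inter> \<rat>) = {0..T}" .
  show ?thesis
    by (rule continuous_le_on_closure[of "{0<..<T} \<inter> \<rat>"]) (use cl f le t in auto)
qed

text \<open>By separability an open set is a countable union of closed balls. A path lies in a
  closed ball about a continuous centre once the inequality holds at rational times, so the preimage
  of a ball is a countable intersection of events on single times.\<close>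

lemma continuous_paths_measurable:
  assumes T: "0 < T" and meas: "\<And>t. t \<in> {0..T} \<Longrightarrow> Y t \<in> borel_measurable M"
    and cont: "\<And>\<omega>. \<omega> \<in> space M \<Longrightarrow> continuous_on {0..T} (\<lambda>t. Y t \<omega>)"
  shows "(\<lambda>\<omega>. restrict (\<lambda>t. Y t \<omega>) {0..T}) \<in> measurable M (borel_of_topology (path_space T))"
  unfolding borel_of_topology_def
proof (rule measurable_measure_of)
  let ?X = "path_space T"
  let ?Y = "\<lambda>\<omega>. restrict (\<lambda>t. Y t \<omega>) {0..T}"
  show "{U. openin ?X U} \<subseteq> Pow (topspace ?X)" by (auto dest: openin_subset)
  show "?Y \<in> space M \<rightarrow> topspace ?X" using cont restrict_in_path_space by blast
  fix U assume "U \<in> {U. openin ?X U}"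
  then have U: "openin ?X U" by simp
  \<comment> \<open>The balls are described by pointwise inequalities because a
    \<open>bernstein_path\<close> need not be extensional and so need not be a point of the
    space.\<close>
  define D where "D = {(qs, r :: rat). {g \<in> topspace ?X. \<forall>t\<in>{0..T}. \<bar>g t - bernstein_path T qs t\<bar> \<le> of_rat r} \<subseteq> U}"
  define A where "A qs r = {\<omega> \<in> space M. \<forall>t\<in>{0..T} \<inter> \<rat>. \<bar>Y t \<omega> - bernstein_path T qs t\<bar> \<le> of_rat r}" for qs and r :: rat
  have bc: "continuous_on S (bernstein_path T qs)" for qs S
    unfolding bernstein_path_def[abs_def] Bernstein_def using T by (intro continuous_intros) auto
  have A_eq: "A qs r = {\<omega> \<in> space M. \<forall>t\<in>{0..T}. \<bar>Y t \<omega> - bernstein_path T qs t\<bar> \<le> of_rat r}" for qs r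
  proof -
    have "\<bar>Y t \<omega> - bernstein_path T qs t\<bar> \<le> of_rat r"
      if "\<omega> \<in> space M" "\<forall>t\<in>{0..T} \<inter> \<rat>. \<bar>Y t \<omega> - bernstein_path T qs t\<bar> \<le> of_rat r" "t \<in> {0..T}" for \<omega> t
      by (rule continuous_on_le_if_le_on_rationals[OF T, of "\<lambda>t. \<bar>Y t \<omega> - bernstein_path T qs t\<bar>"])
         (use that cont bc in \<open>auto intro!: continuous_intros\<close>)
    then show ?thesis unfolding A_def by blast
  qed
  have Am: "A qs r \<in> sets M" for qs r
  proof -
    have eq: "A qs r = {\<omega> \<in> space M. \<forall>q. real_of_rat q \<in> {0..T} \<longrightarrow>
        \<bar>Y (of_rat q) \<omega> - bernstein_path T qs (of_rat q)\<bar> \<le> of_rat r}"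
      unfolding A_def Rats_def by auto
    have "Measurable.pred M (\<lambda>\<omega>. real_of_rat q \<in> {0..T} \<longrightarrow>
        \<bar>Y (of_rat q) \<omega> - bernstein_path T qs (of_rat q)\<bar> \<le> of_rat r)" for q
    proof (cases "real_of_rat q \<in> {0..T}")
      case True
      then have [measurable]: "Y (of_rat q) \<in> borel_measurable M" by (rule meas)
      have "Measurable.pred M (\<lambda>\<omega>. \<bar>Y (of_rat q) \<omega> - c\<bar> \<le> d)" for c d :: real
        by measurable
      from this[of "bernstein_path T qs (of_rat q)" "of_rat r"] True show ?thesis
        by (simp only: simp_thms)
    next
      case False
      then show ?thesis by (simp only: simp_thms) (rule measurable_const, simp)
    qed
    then have "Measurable.pred M (\<lambda>\<omega>. \<forall>q. real_of_rat q \<in> {0..T} \<longrightarrow>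
        \<bar>Y (of_rat q) \<omega> - bernstein_path T qs (of_rat q)\<bar> \<le> of_rat r)"
      by (rule pred_intros_countable(1))
    then show ?thesis unfolding eq pred_def .
  qed
  have "?Y -` U \<inter> space M = (\<Union>(qs, r)\<in>D. A qs r)"
  proof (intro set_eqI iffI)
    fix \<omega> assume "\<omega> \<in> ?Y -` U \<inter> space M"
    then have \<omega>: "\<omega> \<in> space M" "?Y \<omega> \<in> U" by auto
    from U \<omega>(2) T obtain e where e: "0 < e"
      "\<And>g. g \<in> topspace ?X \<Longrightarrow> (\<forall>t\<in>{0..T}. \<bar>?Y \<omega> t - g t\<bar> \<le> e) \<Longrightarrow> g \<in> U"
      unfolding openin_path_space_iff[OF less_imp_le[OF T]] by blast
    \<comment> \<open>With r < e/2 the triangle inequality keeps the ball of radius \<open>r\<close>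
      about the approximating polynomial within distance \<open>e\<close> of the path, hence inside
      \<open>U\<close>.\<close>
    obtain r :: rat where r: "0 < real_of_rat r" "real_of_rat r < e / 2"
      using of_rat_dense[of 0 "e / 2"] e(1) by auto
    obtain qs where qs: "\<And>t. t \<in> {0..T} \<Longrightarrow> \<bar>Y t \<omega> - bernstein_path T qs t\<bar> \<le> of_rat r"
      using bernstein_path_dense[OF T cont[OF \<omega>(1)] r(1)] by blast
    have "(qs, r) \<in> D"
      unfolding D_def
    proof clarsimp
      fix g assume g: "g \<in> topspace ?X" "\<forall>t\<in>{0..T}. \<bar>g t - bernstein_path T qs t\<bar> \<le> of_rat r"
      have "\<bar>?Y \<omega> t - g t\<bar> \<le> e" if "t \<in> {0..T}" for t
        using qs[OF that] g(2)[rule_format, OF that] r(2) that by simp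
      then show "g \<in> U" using e(2) g(1) by blast
    qed
    moreover have "\<omega> \<in> A qs r" unfolding A_eq using \<omega>(1) qs by blast
    ultimately show "\<omega> \<in> (\<Union>(qs, r)\<in>D. A qs r)" by blast
  next
    fix \<omega> assume "\<omega> \<in> (\<Union>(qs, r)\<in>D. A qs r)"
    then obtain qs r where D: "(qs, r) \<in> D" and A: "\<omega> \<in> A qs r" by blast
    then have \<omega>: "\<omega> \<in> space M" "\<forall>t\<in>{0..T}. \<bar>?Y \<omega> t - bernstein_path T qs t\<bar> \<le> of_rat r"
      unfolding A_eq by auto
    with D have "?Y \<omega> \<in> U"
      unfolding D_def using restrict_in_path_space[OF cont] by blast
    with \<omega>(1) show "\<omega> \<in> ?Y -` U \<inter> space M" by simp
  qed
  also have "\<dots> \<in> sets M"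
    by (rule sets.countable_UN'') (auto intro: Am countableI_type)
  finally show "?Y -` U \<inter> space M \<in> sets M" .
qed

lemma continuous_map_measurable_borel_of_topology:
  assumes "continuous_map X euclideanreal F"
  shows "F \<in> borel_measurable (borel_of_topology X)"
proof (rule borel_measurableI)
  fix S :: "real set" assume "open S"
  have sp: "space (borel_of_topology X) = topspace X"
    unfolding borel_of_topology_def by (rule space_measure_of) (auto dest: openin_subset)
  have "openin X {x \<in> topspace X. F x \<in> S}"
    using assms \<open>open S\<close> unfolding continuous_map_def by auto
  moreover have "F -` S \<inter> space (borel_of_topology X) = {x \<in> topspace X. F x \<in> S}"
    unfolding sp by auto
  ultimately show "F -` S \<inter> space (borel_of_topology X) \<in> sets (borel_of_topology X)"
    unfolding borel_of_topology_def
    by (subst sets_measure_of) (auto dest: openin_subset intro: sigma_sets.Basic)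
qed

text \<open>On a common probability space, uniform convergence of the paths is convergence in the
  path space. A bounded continuous functional preserves it, and dominated convergence gives the
  limit of the expectations.\<close>

lemma path_laws_weakly_converge:
  fixes Z :: "nat \<Rightarrow> real \<Rightarrow> 'a \<Rightarrow> real"
  assumes M: "prob_space M" and T: "0 < T"
    and meas: "\<And>n t. t \<in> {0..T} \<Longrightarrow> Z n t \<in> borel_measurable M" "\<And>t. t \<in> {0..T} \<Longrightarrow> Y t \<in> borel_measurable M"
    and cont: "\<And>n \<omega>. \<omega> \<in> space M \<Longrightarrow> continuous_on {0..T} (\<lambda>t. Z n t \<omega>)"
      "\<And>\<omega>. \<omega> \<in> space M \<Longrightarrow> continuous_on {0..T} (\<lambda>t. Y t \<omega>)"
    and conv: "AE \<omega> in M. uniform_limit {0..T} (\<lambda>n t. Z n t \<omega>) (\<lambda>t. Y t \<omega>) sequentially"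
  shows "weakly_converges (path_space T) (\<lambda>n. path_law M T (Z n)) (path_law M T Y)"
proof -
  interpret M: prob_space M by fact
  let ?B = "borel_of_topology (path_space T)"
  let ?Y = "\<lambda>\<omega>. restrict (\<lambda>t. Y t \<omega>) {0..T}"
  let ?Z = "\<lambda>n \<omega>. restrict (\<lambda>t. Z n t \<omega>) {0..T}"
  have Zm: "?Z n \<in> measurable M ?B" for n
    by (rule continuous_paths_measurable[OF T meas(1) cont(1)])
  have Ym: "?Y \<in> measurable M ?B"
    by (rule continuous_paths_measurable[OF T meas(2) cont(2)])
  have sp: "space ?B = topspace (path_space T)"
    unfolding borel_of_topology_def by (rule space_measure_of) (auto dest: openin_subset)
  have law: "borel_prob_on (path_space T) (path_law M T V)"
    if "(\<lambda>\<omega>. restrict (\<lambda>t. V t \<omega>) {0..T}) \<in> measurable M ?B" for V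
    unfolding borel_prob_on_def path_law_def using M.prob_space_distr[OF that] sp by simp
  have "(\<lambda>n. \<integral>x. F x \<partial>path_law M T (Z n)) \<longlonglongrightarrow> (\<integral>x. F x \<partial>path_law M T Y)"
    if F: "continuous_map (path_space T) euclideanreal F" and bd: "bounded (F ` topspace (path_space T))" for F
  proof -
    have Fm: "F \<in> borel_measurable ?B" by (rule continuous_map_measurable_borel_of_topology[OF F])
    obtain K where K: "\<And>f. f \<in> topspace (path_space T) \<Longrightarrow> \<bar>F f\<bar> \<le> K"
      using bd unfolding bounded_iff by auto
    have "(\<lambda>n. \<integral>\<omega>. F (?Z n \<omega>) \<partial>M) \<longlonglongrightarrow> (\<integral>\<omega>. F (?Y \<omega>) \<partial>M)"
    proof (rule integral_dominated_convergence[where w = "\<lambda>_. K"])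
      show "(\<lambda>\<omega>. F (?Y \<omega>)) \<in> borel_measurable M" "(\<lambda>\<omega>. F (?Z n \<omega>)) \<in> borel_measurable M" for n
        using measurable_compose[OF Ym Fm] measurable_compose[OF Zm Fm] by auto
      show "AE \<omega> in M. norm (F (?Z n \<omega>)) \<le> K" for n
        using K restrict_in_path_space[OF cont(1)] by (intro AE_I2) auto
      show "AE \<omega> in M. (\<lambda>n. F (?Z n \<omega>)) \<longlonglongrightarrow> F (?Y \<omega>)"
        using conv AE_space
      proof eventually_elim
        case (elim \<omega>)
        have "limitin (path_space T) (\<lambda>n. ?Z n \<omega>) (?Y \<omega>) sequentially"
          unfolding limitin_def
        proof (intro conjI allI impI)
          show "?Y \<omega> \<in> topspace (path_space T)" using restrict_in_path_space[OF cont(2)[OF elim(2)]] .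
          fix U assume "openin (path_space T) U \<and> ?Y \<omega> \<in> U"
          then obtain r where r: "0 < r"
            "\<And>g. g \<in> topspace (path_space T) \<Longrightarrow> (\<forall>t\<in>{0..T}. \<bar>?Y \<omega> t - g t\<bar> \<le> r) \<Longrightarrow> g \<in> U"
            unfolding openin_path_space_iff[OF less_imp_le[OF T]] by blast
          have "\<forall>\<^sub>F n in sequentially. \<forall>t\<in>{0..T}. dist (Z n t \<omega>) (Y t \<omega>) < r"
            using elim(1) r(1) by (rule uniform_limitD)
          then show "\<forall>\<^sub>F n in sequentially. ?Z n \<omega> \<in> U"
          proof eventually_elim
            case (elim n)
            then show ?case
              using r(2)[OF restrict_in_path_space[OF cont(1)[OF \<open>\<omega> \<in> space M\<close>, of n]]]
              by (force simp: dist_real_def)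
          qed
        qed
        from continuous_map_limit[OF F this] show ?case by (simp add: o_def)
      qed
    qed simp_all
    then show ?thesis
      unfolding path_law_def by (simp add: integral_distr[OF Zm Fm] integral_distr[OF Ym Fm])
  qed
  then show ?thesis
    unfolding weakly_converges_def using law[OF Zm] law[OF Ym] by blast
qed

subsection \<open>Convergence of Wiener convolutions\<close>

text \<open>The pathwise bound depends on t only through a variation over \<open>{0..t}\<close>,
  which is at most \<open>V n\<close>. It therefore becomes uniform once the null sets for rational
  times and all n are united and continuity fills in the other times.\<close>

lemma wiener_convolutions_uniform_limit:
  fixes Z :: "nat \<Rightarrow> real \<Rightarrow> 'a \<Rightarrow> real"
  assumes W: "brownian_motion M W" and T: "0 < T"
    and Z: "\<And>n. continuous_wiener_convolution M W T (k n) (Z n)"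
    and Y: "continuous_wiener_convolution M W T K Y"
    and k0: "\<And>n. k n 0 = K 0"
    and H: "\<And>n u v. 0 \<le> v \<Longrightarrow> v \<le> u \<Longrightarrow> u \<le> T \<Longrightarrow> \<bar>(k n u - K u) - (k n v - K v)\<bar> \<le> H n u - H n v"
    and V: "\<And>n. H n T - H n 0 \<le> V n" "V \<longlonglongrightarrow> 0"
  shows "AE \<omega> in M. uniform_limit {0..T} (\<lambda>n t. Z n t \<omega>) (\<lambda>t. Y t \<omega>) sequentially"
proof -
  have 1: "AE \<omega> in M. \<forall>C. (\<forall>r\<in>{0..T}. \<bar>W r \<omega>\<bar> \<le> C) \<longrightarrow> \<bar>Z n t \<omega> - Y t \<omega>\<bar> \<le> 2 * V n * C"
    if t: "t \<in> {0..T}" for n t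
  proof -
    have ZI: "has_wiener_integral M W t (\<lambda>\<tau>. k n (t - \<tau>)) (Z n t)"
      and YI: "has_wiener_integral M W t (\<lambda>\<tau>. K (t - \<tau>)) (Y t)"
      using Z Y t unfolding continuous_wiener_convolution_def by auto
    \<comment> \<open>Under the reversal \<tau> to t - \<tau> the increasing \<open>H n\<close>
      becomes a decreasing majorant, and \<open>k n 0 = K 0\<close> becomes equality of the
      integrands at \<tau> = t.\<close>
    have "AE \<omega> in M. \<forall>C. (\<forall>r\<in>{0..t}. \<bar>W r \<omega>\<bar> \<le> C) \<longrightarrow>
        \<bar>Z n t \<omega> - Y t \<omega>\<bar> \<le> 2 * (H n (t - 0) - H n (t - t)) * C"
      by (rule wiener_integral_diff_bound[OF W _ ZI YI]) (use t k0 H in auto)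
    then show ?thesis
    proof eventually_elim
      case (elim \<omega>)
      show ?case
      proof (intro allI impI)
        fix C assume C: "\<forall>r\<in>{0..T}. \<bar>W r \<omega>\<bar> \<le> C"
        have "0 \<le> \<bar>W 0 \<omega>\<bar>" by simp
        also have "\<dots> \<le> C" using C T by auto
        finally have C0: "0 \<le> C" .
        have "\<bar>Z n t \<omega> - Y t \<omega>\<bar> \<le> 2 * (H n t - H n 0) * C"
          using elim C t by simp
        also have "\<dots> \<le> 2 * V n * C"
          using H[of t T n] V(1)[of n] t C0 abs_ge_zero[of "(k n T - K T) - (k n t - K t)"]
          by (intro mult_right_mono mult_left_mono) auto
        finally show "\<bar>Z n t \<omega> - Y t \<omega>\<bar> \<le> 2 * V n * C" .
      qed
    qed
  qed
  have "AE \<omega> in M. \<forall>n. \<forall>q. real_of_rat q \<in> {0..T} \<longrightarrow> (\<forall>C. (\<forall>r\<in>{0..T}. \<bar>W r \<omega>\<bar> \<le> C) \<longrightarrow>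
      \<bar>Z n (of_rat q) \<omega> - Y (of_rat q) \<omega>\<bar> \<le> 2 * V n * C)"
    unfolding AE_all_countable by (intro allI AE_impI 1)
  moreover have "AE \<omega> in M. continuous_on {0..} (\<lambda>t. W t \<omega>)"
    using W unfolding brownian_motion_def by blast
  ultimately show ?thesis
    using AE_space
  proof eventually_elim
    case (elim \<omega>)
    have "continuous_on {0..T} (\<lambda>t. W t \<omega>)" by (rule continuous_on_subset[OF elim(2)]) auto
    then have "bounded ((\<lambda>t. W t \<omega>) ` {0..T})"
      by (intro compact_imp_bounded compact_continuous_image) auto
    then obtain C where "\<forall>x\<in>(\<lambda>t. W t \<omega>) ` {0..T}. norm x \<le> C" unfolding bounded_iff ..
    then have C: "\<forall>r\<in>{0..T}. \<bar>W r \<omega>\<bar> \<le> C" by simp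
    have cont: "continuous_on {0..T} (\<lambda>t. Z n t \<omega>)" "continuous_on {0..T} (\<lambda>t. Y t \<omega>)" for n
      using Z Y elim(3) unfolding continuous_wiener_convolution_def by auto
    have le: "\<bar>Z n t \<omega> - Y t \<omega>\<bar> \<le> 2 * V n * C" if "t \<in> {0..T}" for n t
    proof (rule continuous_on_le_if_le_on_rationals[OF T _ _ that])
      show "continuous_on {0..T} (\<lambda>t. \<bar>Z n t \<omega> - Y t \<omega>\<bar>)" using cont by (intro continuous_intros)
      fix r :: real assume r: "r \<in> {0..T} \<inter> \<rat>"
      then obtain q where q: "r = of_rat q" by (auto elim: Rats_cases)
      have "real_of_rat q \<in> {0..T}" using r q by simp
      then show "\<bar>Z n r \<omega> - Y r \<omega>\<bar> \<le> 2 * V n * C"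
        unfolding q using elim(1) C by blast
    qed
    have lim: "(\<lambda>n. 2 * V n * C) \<longlonglongrightarrow> 0"
      using tendsto_mult[OF tendsto_mult[OF tendsto_const[of 2] V(2)] tendsto_const[of C]] by simp
    show ?case
    proof (rule uniform_limitI)
      fix e :: real assume "0 < e"
      then have "\<forall>\<^sub>F n in sequentially. 2 * V n * C < e" using lim by (intro order_tendstoD)
      then show "\<forall>\<^sub>F n in sequentially. \<forall>t\<in>{0..T}. dist (Z n t \<omega>) (Y t \<omega>) < e"
      proof eventually_elim
        case (elim n)
        then show ?case
          unfolding dist_real_def by (intro ballI) (rule order.strict_trans1[OF le])
      qed
    qed
  qed
qed

theorem theorem3p4:
  fixes \<rho> \<mu> l T :: real
    and N :: "'b measure" and \<alpha> :: "nat \<Rightarrow> 'b \<Rightarrow> real"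
    and M :: "'a measure" and W :: "real \<Rightarrow> 'a \<Rightarrow> real"
    and s :: "real \<Rightarrow> real \<Rightarrow> real"
    and Yn :: "nat \<Rightarrow> 'b \<Rightarrow> real \<Rightarrow> 'a \<Rightarrow> real" and Y :: "real \<Rightarrow> 'a \<Rightarrow> real"
  assumes "1 < \<rho>" "\<rho> \<le> 2" "\<mu> > 0" "l > 0" "T > 0"
    and "prob_space N"
    and "prob_space.indep_vars N (\<lambda>_. borel) \<alpha> {1..}"
    and "\<And>k. k \<ge> 1 \<Longrightarrow> distributed N lborel (\<alpha> k) (\<lambda>x. ennreal (gamma_density \<mu> l x))"
    and "brownian_motion M W"
    and "\<And>a. a \<ge> 0 \<Longrightarrow> scalar_resolvent \<rho> a (s a)"
    and "AE \<omega>' in N. \<forall>n\<ge>1. continuous_wiener_convolution M W T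
           (\<lambda>u. 1 / real n * (\<Sum>k=1..n. s (\<alpha> k \<omega>') u)) (Yn n \<omega>')"
    and "continuous_wiener_convolution M W T (\<lambda>u. G_fun \<rho> \<mu> (- (u powr \<rho> / l))) Y"
  shows "AE \<omega>' in N. weakly_converges (path_space T)
           (\<lambda>n. path_law M T (Yn (Suc n) \<omega>')) (path_law M T Y)"
proof -
  note \<rho> = assms(1,2) and T = assms(5)
  \<comment> \<open>Any positive \<open>e\<close> below l/2 would do, as the second moment of
    \<open>exp (e * x)\<close> must be finite.\<close>
  define e where "e = l / 4"
  have e: "0 < e" "2 * e < l" using assms(4) by (auto simp: e_def)
  have samples_nonneg: "AE \<omega>' in N. \<forall>k. 0 \<le> \<alpha> (Suc k) \<omega>'"
    by (rule gamma_samples_nonneg[OF assms(6,3,4,7)]) (rule assms(8))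
  have samples_moments: "AE \<omega>' in N. \<forall>j. (\<lambda>n. (\<Sum>i<Suc n. \<alpha> (Suc i) \<omega>' ^ j) / real (Suc n))
      \<longlonglongrightarrow> pochhammer \<mu> j / l ^ j"
    by (rule gamma_samples_moments[OF assms(6,3,4,7)]) (rule assms(8))
  have "\<exists>E. AE \<omega>' in N. (\<lambda>n. (\<Sum>i<Suc n. exp (e * \<alpha> (Suc i) \<omega>')) / real (Suc n)) \<longlonglongrightarrow> E"
    by (rule gamma_samples_exp_moment[OF assms(6,3,4,7) _ e(2)]) (rule assms(8))
  then obtain E where E: "AE \<omega>' in N. (\<lambda>n. (\<Sum>i<Suc n. exp (e * \<alpha> (Suc i) \<omega>')) / real (Suc n)) \<longlonglongrightarrow> E" ..
  define R where "R = T powr \<rho>"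
  have R: "0 < R" using T by (simp add: R_def)
  define g where "g j = Gamma (\<rho> * real j + 1)" for j
  have g: "0 < g j" for j unfolding g_def using \<rho> by (intro Gamma_real_pos add_nonneg_pos) auto
  define m where "m j = pochhammer \<mu> j / l ^ j" for j
  have fact_g: "summable (\<lambda>j. y ^ j * fact j / g j)" if "0 < y" for y
    unfolding g_def by (rule fact_over_Gamma_summable[OF that \<rho>])
  have pow_g: "summable (\<lambda>j. y ^ j / g j)" if "0 < y" for y
  proof (rule summable_comparison_test'[OF fact_g[OF that], of 0])
    fix j
    show "norm (y ^ j / g j) \<le> y ^ j * fact j / g j"
      using that g[of j] fact_ge_1[of j, where 'a = real] by (simp add: divide_right_mono)
  qed
  \<comment> \<open>Up to rearrangement this is the general term of \<open>fact_g\<close> at y =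
    R/e.\<close>
  have c_lim: "(\<lambda>j. R ^ j / g j * fact j / e ^ j) \<longlonglongrightarrow> 0"
    using summable_LIMSEQ_zero[OF fact_g[of "R / e"]] R e by (simp add: power_divide field_simps)
  \<comment> \<open>Outside one null set of \<open>N\<close> the sample becomes a fixed sequence
    with convergent averages; the remaining randomness is that of \<open>W\<close>.\<close>
  show ?thesis
    using assms(11) samples_nonneg samples_moments E
  proof eventually_elim
    case (elim \<omega>')
    define x where "x k = \<alpha> (Suc k) \<omega>'" for k
    define a where "a n j = (\<Sum>k<Suc n. x k ^ j) / real (Suc n)" for n j
    \<comment> \<open>These are the coefficients of the kernel difference in powers of -(u powr
      \<rho>). With weights R^j/g_j the moment distance is precisely the sum of |b_j| R^j.\<close>
    define b where "b n j = (a n j - m j) / g j" for n j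
    define k where "k n u = 1 / real (Suc n) * (\<Sum>i=1..Suc n. s (\<alpha> i \<omega>') u)" for n u
    define K where "K u = G_fun \<rho> \<mu> (- (u powr \<rho> / l))" for u
    define H where "H n u = (\<Sum>j. \<bar>b n j\<bar> * (u powr \<rho>) ^ j)" for n u
    have x0: "0 \<le> x i" for i using elim(2) by (simp add: x_def)
    have mom: "(\<lambda>n. (\<Sum>k<Suc n. x k ^ j) / real (Suc n)) \<longlonglongrightarrow> m j" for j
      using elim(3) unfolding x_def m_def by blast
    have ex: "(\<lambda>n. (\<Sum>k<Suc n. exp (e * x k)) / real (Suc n)) \<longlonglongrightarrow> E"
      using elim(4) unfolding x_def .
    have c0: "0 \<le> R ^ j / g j" for j using R g[of j] by simp
    note avg = average_series_tendsto[OF x0 e(1) c0 c_lim mom ex, folded a_def]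
    have b_eq: "\<bar>b n j\<bar> * R ^ j = R ^ j / g j * \<bar>a n j - m j\<bar>" for n j
      using g[of j] by (simp add: b_def abs_divide)
    have b_sum: "summable (\<lambda>j. \<bar>b n j\<bar> * R ^ j)" for n
      unfolding b_eq by (rule avg(1))
    have V_lim: "(\<lambda>n. \<Sum>j. \<bar>b n j\<bar> * R ^ j) \<longlonglongrightarrow> 0"
      unfolding b_eq by (rule avg(3))
    have powR: "0 \<le> u powr \<rho>" "u powr \<rho> \<le> R" if "0 \<le> u" "u \<le> T" for u
      unfolding R_def using that \<rho> by (auto intro: powr_mono2)
    have k_sums: "(\<lambda>j. a n j / g j * (- (u powr \<rho>)) ^ j) sums k n u" if "0 \<le> u" for n u
    proof -
      have "(\<lambda>j. \<Sum>i<Suc n. (- x i * u powr \<rho>) ^ j / g j) sums (\<Sum>i<Suc n. s (x i) u)"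
      proof (rule sums_sum)
        fix i
        show "(\<lambda>j. (- x i * u powr \<rho>) ^ j / g j) sums s (x i) u"
          unfolding g_def
          by (rule scalar_resolvent_sums[OF \<rho>(1) x0 assms(10)[OF x0] that])
             (use pow_g in \<open>simp add: g_def\<close>)
      qed
      from sums_mult[OF this, of "1 / real (Suc n)"]
      have "(\<lambda>j. 1 / real (Suc n) * (\<Sum>i<Suc n. (- x i * u powr \<rho>) ^ j / g j)) sums
          (1 / real (Suc n) * (\<Sum>i<Suc n. s (x i) u))" .
      moreover have "(\<Sum>i<Suc n. s (x i) u) = (\<Sum>i=1..Suc n. s (\<alpha> i \<omega>') u)"
        unfolding x_def by (rule sum.reindex_bij_witness[of _ "\<lambda>i. i - 1" Suc]) auto
      moreover have "1 / real (Suc n) * (\<Sum>i<Suc n. (- x i * u powr \<rho>) ^ j / g j)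
          = a n j / g j * (- (u powr \<rho>)) ^ j" for j
      proof -
        have "(- x i * u powr \<rho>) ^ j = x i ^ j * (- (u powr \<rho>)) ^ j" for i
          by (simp add: power_mult_distrib[symmetric])
        then show ?thesis
          unfolding a_def by (simp only: sum_divide_distrib[symmetric] sum_distrib_right[symmetric]) simp
      qed
      ultimately show ?thesis unfolding k_def by (simp only:)
    qed
    \<comment> \<open>Summability comes from the bound on the limit moments weighted with R^j/g_j,
      hence the restriction to u \<le> T.\<close>
    have K_sums: "(\<lambda>j. m j / g j * (- (u powr \<rho>)) ^ j) sums K u" if "0 \<le> u" "u \<le> T" for u
    proof -
      have "summable (\<lambda>j. m j / g j * (- (u powr \<rho>)) ^ j)"
      proof (rule summable_comparison_test'[OF avg(2), of 0])
        fix j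
        have "\<bar>(- (u powr \<rho>)) ^ j\<bar> \<le> R ^ j"
          using powR[OF that] by (simp add: power_abs power_mono)
        from mult_left_mono[OF this, of "\<bar>m j\<bar> / g j"]
        show "norm (m j / g j * (- (u powr \<rho>)) ^ j) \<le> R ^ j / g j * \<bar>m j\<bar>"
          using g[of j] by (simp add: abs_mult mult_ac)
      qed
      moreover have "K u = (\<Sum>j. m j / g j * (- (u powr \<rho>)) ^ j)"
        unfolding K_def G_fun_def m_def g_def
      proof (rule suminf_cong)
        fix j
        have "(- (u powr \<rho> / l)) ^ j = (- (u powr \<rho>)) ^ j / l ^ j"
          by (simp only: power_divide[symmetric] minus_divide_left)
        then show "pochhammer \<mu> j / Gamma (real j * \<rho> + 1) * (- (u powr \<rho> / l)) ^ j
          = pochhammer \<mu> j / l ^ j / Gamma (\<rho> * real j + 1) * (- (u powr \<rho>)) ^ j"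
          by (simp add: mult.commute)
      qed
      ultimately show ?thesis by (simp add: summable_sums)
    qed
    have h_eq: "k n u - K u = (\<Sum>j. b n j * (- (u powr \<rho>)) ^ j)" if "0 \<le> u" "u \<le> T" for n u
      using sums_unique[OF sums_diff[OF k_sums[OF that(1), of n] K_sums[OF that]]]
      by (simp add: b_def diff_divide_distrib left_diff_distrib)
    have "AE \<omega> in M. uniform_limit {0..T} (\<lambda>n t. Yn (Suc n) \<omega>' t \<omega>) (\<lambda>t. Y t \<omega>) sequentially"
    proof (rule wiener_convolutions_uniform_limit[OF assms(9) T _ _ _ _ _ V_lim])
      show "continuous_wiener_convolution M W T (k n) (Yn (Suc n) \<omega>')" for n
        using elim(1)[rule_format, of "Suc n"] unfolding k_def by simp
      show "continuous_wiener_convolution M W T K Y"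
        using assms(12) unfolding K_def .
      \<comment> \<open>At 0 only the constant term survives, and the empirical and the true moment
        of order 0 are both 1.\<close>
      show "k n 0 = K 0" for n
      proof -
        have "k n 0 - K 0 = (\<Sum>j. b n j * 0 ^ j)" using h_eq[of 0 n] T \<rho> by simp
        also have "\<dots> = b n 0" by (rule powser_zero)
        also have "\<dots> = 0" by (simp add: b_def a_def m_def)
        finally show ?thesis by simp
      qed
      show "\<bar>(k n u - K u) - (k n v - K v)\<bar> \<le> H n u - H n v" if "0 \<le> v" "v \<le> u" "u \<le> T" for n u v
        unfolding H_def using that h_eq[of u n] h_eq[of v n] \<rho> powR
        by (simp only: order.trans[OF that(1,2)] order.trans[OF that(2,3)] simp_thms)
           (intro power_series_oscillation[OF b_sum], auto intro: powr_mono2)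
      \<comment> \<open>At \<open>T\<close> the majorant is the series at \<open>R\<close>, and its
        value \<open>\<bar>b n 0\<bar>\<close> at 0 is nonnegative.\<close>
      show "H n T - H n 0 \<le> (\<Sum>j. \<bar>b n j\<bar> * R ^ j)" for n
        unfolding H_def R_def[symmetric] using \<rho> powser_zero[of "\<lambda>j. \<bar>b n j\<bar>"] by simp
    qed
    then show ?case
    proof (rule path_laws_weakly_converge[rotated -1])
      show "prob_space M" using assms(9) unfolding brownian_motion_def by blast
    qed (use T elim(1) assms(12) in \<open>auto simp: continuous_wiener_convolution_def has_wiener_integral_def\<close>)
  qed
qed

end
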